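(* For each $n\ge0$, the cosimplicial simplicial set $\mathrm{sk}_n\Delta^\bullet_*$ is pro-equivalent to the empty set, thought of as a constant cosimplicial simplicial set with value $\emptyset$. Moreover, $$\operatorname{Tot}^k\mathrm{sk}_n\Delta^\bullet_*=\emptyset$$ whenever $k\ge n+1$.
   Context: $\mathbf{\Delta}$ is the category of finite nonempty totally ordered sets and order-preserving maps; $\Delta^\bullet_*$ is the standard cosimplicial simplicial set $\Delta^p_k=\hom_{\mathbf{\Delta}}([k],[p])$, and $\mathrm{sk}_n\Delta^\bullet_*$ is obtained by taking the $n$-skeleton in each cosimplicial degree. For a cosimplicial object $X^\bullet$, $\operatorname{Tot}^rX^\bullet:=\operatorname{holim}_{\mathbf{\Delta}_r}X^\bullet|_{\mathbf{\Delta}_r}$, the (homotopy invariant) homotopy limit in unpointed simplicial sets with the usual model structure, where $\mathbf{\Delta}_r\subset\mathbf{\Delta}$ is the full subcategory of sets with at most $r+1$ elements; note that $\mathrm{sk}_n\Delta_*^\bullet$ is not a fibrant cosimplicial simplicial set. The $\operatorname{Tot}$-tower of $X^\bullet$ is $\{\operatorname{Tot}^rX^\bullet\}_{r\ge0}$ with restriction maps. Pro-equivalence of two cosimplicial objects means pro-equivalence (weak pro-homotopy equivalence) of their $\operatorname{Tot}$-towers. A map of towers $\{f_s\}:\{A_s\}\to\{B_s\}$ is a pro-isomorphism if for each $s$ there are a $t$ and a map $B_{s+t}\to A_s$ making both triangles commute in the square formed by $f_{s+t}$, $f_s$ and the structure maps; a map of towers is a weak pro-homotopy equivalence if it induces pro-isomorphisms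 on $\pi_0$ and on the higher homotopy groups. In particular, if a map induces weak equivalences $\operatorname{Tot}^rX^\bullet\simeq\operatorname{Tot}^rY^\bullet$ for all $r$ greater than or equal to some fixed integer, then the towers are pro-equivalent. *)

theory Defs
  imports "HOL-Homology.Homology"
begin

section \<open>Small categories and the simplex category\<close>

record ('o, 'm) small_cat =
  Obj :: "'o set"
  Hom :: "'o \<Rightarrow> 'o \<Rightarrow> 'm set"
  Ident :: "'o \<Rightarrow> 'm"
  Comp :: "'o \<Rightarrow> 'o \<Rightarrow> 'o \<Rightarrow> 'm \<Rightarrow> 'm \<Rightarrow> 'm"

text \<open>\<open>Comp C a b c g f\<close> is the composite of \<open>f : a \<rightarrow> b\<close> followed by \<open>g : b \<rightarrow> c\<close>.  The simplex
  category is represented by its skeleton: the object \<open>n\<close> stands for \<open>[n] = {0, \<dots>, n}\<close>, a set with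
  \<open>n + 1\<close> elements.\<close>

definition Delta_hom :: "nat \<Rightarrow> nat \<Rightarrow> (nat \<Rightarrow> nat) set" where
  "Delta_hom m n = {\<theta> \<in> {..m} \<rightarrow>\<^sub>E {..n}. mono_on {..m} \<theta>}"

text \<open>\<open>Delta_trunc r\<close> is the full subcategory on the sets with at most \<open>r + 1\<close> elements.\<close>

definition Delta_trunc :: "nat \<Rightarrow> (nat, nat \<Rightarrow> nat) small_cat" where
  "Delta_trunc r =
    \<lparr>Obj = {..r}, Hom = Delta_hom, Ident = (\<lambda>a. \<lambda>i\<in>{..a}. i),
     Comp = (\<lambda>a b c g f. compose {..a} g f)\<rparr>"

text \<open>The category of objects of \<open>C\<close> over \<open>c\<close>.\<close>

definition over_cat :: "('o, 'm) small_cat \<Rightarrow> 'o \<Rightarrow> ('o \<times> 'm, 'm) small_cat" where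
  "over_cat C c =
    \<lparr>Obj = {(a, f). a \<in> Obj C \<and> f \<in> Hom C a c},
     Hom = (\<lambda>(a, f) (b, g). {h \<in> Hom C a b. Comp C a b c g h = f}),
     Ident = (\<lambda>(a, f). Ident C a),
     Comp = (\<lambda>x y z. Comp C (fst x) (fst y) (fst z))\<rparr>"


section \<open>Simplicial sets\<close>

text \<open>\<open>act X m n \<theta>\<close> is the operator from \<open>n\<close>-simplices to \<open>m\<close>-simplices induced by
  \<open>\<theta> : [m] \<rightarrow> [n]\<close>.\<close>

record 'a sset =
  simplices :: "nat \<Rightarrow> 'a set"
  act :: "nat \<Rightarrow> nat \<Rightarrow> (nat \<Rightarrow> nat) \<Rightarrow> 'a \<Rightarrow> 'a"

definition is_sset :: "'a sset \<Rightarrow> bool" where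
  "is_sset X \<longleftrightarrow>
    (\<forall>m n. \<forall>\<theta>\<in>Delta_hom m n. act X m n \<theta> \<in> simplices X n \<rightarrow> simplices X m) \<and>
    (\<forall>n. \<forall>x\<in>simplices X n. act X n n (\<lambda>i\<in>{..n}. i) x = x) \<and>
    (\<forall>l m n. \<forall>\<phi>\<in>Delta_hom l m. \<forall>\<theta>\<in>Delta_hom m n. \<forall>x\<in>simplices X n.
       act X l m \<phi> (act X m n \<theta> x) = act X l n (compose {..l} \<theta> \<phi>) x)"

definition sset_hom :: "'a sset \<Rightarrow> 'b sset \<Rightarrow> (nat \<Rightarrow> 'a \<Rightarrow> 'b) set" where
  "sset_hom X Y =
    {f. (\<forall>n. f n \<in> simplices X n \<rightarrow>\<^sub>E simplices Y n) \<and>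
        (\<forall>m n. \<forall>\<theta>\<in>Delta_hom m n. \<forall>x\<in>simplices X n. f m (act X m n \<theta> x) = act Y m n \<theta> (f n x))}"

definition empty_sset :: "'a sset" where
  "empty_sset = \<lparr>simplices = (\<lambda>n. {}), act = (\<lambda>m n \<theta> x. x)\<rparr>"

definition std_simplex :: "nat \<Rightarrow> (nat \<Rightarrow> nat) sset" where
  "std_simplex p =
    \<lparr>simplices = (\<lambda>k. Delta_hom k p), act = (\<lambda>m n \<theta> x. compose {..m} x \<theta>)\<rparr>"

definition prod_sset :: "'a sset \<Rightarrow> 'b sset \<Rightarrow> ('a \<times> 'b) sset" where
  "prod_sset X Y =
    \<lparr>simplices = (\<lambda>n. simplices X n \<times> simplices Y n),
     act = (\<lambda>m n \<theta>. map_prod (act X m n \<theta>) (act Y m n \<theta>))\<rparr>"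

text \<open>The \<open>n\<close>-skeleton is the simplicial subset generated by the simplices of dimension at most
  \<open>n\<close>.\<close>

definition skeleton :: "nat \<Rightarrow> 'a sset \<Rightarrow> 'a sset" where
  "skeleton n X =
    \<lparr>simplices = (\<lambda>k. {act X k j \<theta> y | j \<theta> y. j \<le> n \<and> \<theta> \<in> Delta_hom k j \<and> y \<in> simplices X j}),
     act = act X\<rparr>"

text \<open>A \<open>k\<close>-simplex of the nerve is a functor from the poset \<open>[k]\<close> to \<open>C\<close>, given by its object
  part \<open>A\<close> and its morphism part \<open>H\<close>, where \<open>H (i, j) : A i \<rightarrow> A j\<close> for \<open>i \<le> j\<close>.\<close>

definition nerve :: "('o, 'm) small_cat \<Rightarrow> ((nat \<Rightarrow> 'o) \<times> (nat \<times> nat \<Rightarrow> 'm)) sset" where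
  "nerve C =
    \<lparr>simplices = (\<lambda>k. {(A, H).
       A \<in> {..k} \<rightarrow>\<^sub>E Obj C \<and>
       H \<in> (\<Pi>\<^sub>E (i, j)\<in>{(i, j). i \<le> j \<and> j \<le> k}. Hom C (A i) (A j)) \<and>
       (\<forall>i\<le>k. H (i, i) = Ident C (A i)) \<and>
       (\<forall>i j l. i \<le> j \<and> j \<le> l \<and> l \<le> k \<longrightarrow>
          H (i, l) = Comp C (A i) (A j) (A l) (H (j, l)) (H (i, j)))}),
     act = (\<lambda>m n \<theta> (A, H).
       (\<lambda>i\<in>{..m}. A (\<theta> i), \<lambda>(i, j)\<in>{(i, j). i \<le> j \<and> j \<le> m}. H (\<theta> i, \<theta> j)))\<rparr>"

text \<open>The map of nerves \<open>N(C/c) \<rightarrow> N(C/d)\<close> in dimension \<open>k\<close> given by composition with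
  \<open>u : c \<rightarrow> d\<close>.\<close>

definition over_nerve_map ::
  "('o, 'm) small_cat \<Rightarrow> 'o \<Rightarrow> 'o \<Rightarrow> 'm \<Rightarrow> nat \<Rightarrow>
   (nat \<Rightarrow> 'o \<times> 'm) \<times> (nat \<times> nat \<Rightarrow> 'm) \<Rightarrow> (nat \<Rightarrow> 'o \<times> 'm) \<times> (nat \<times> nat \<Rightarrow> 'm)" where
  "over_nerve_map C c d u k =
    (\<lambda>(A, H). (\<lambda>i\<in>{..k}. (fst (A i), Comp C (fst (A i)) c d u (snd (A i))), H))"


section \<open>Geometric realization and the singular complex\<close>

text \<open>\<open>simplex_push m \<theta>\<close> is the affine map of standard topological simplices that is \<open>\<theta>\<close> on
  vertices.\<close>

definition simplex_push :: "nat \<Rightarrow> (nat \<Rightarrow> nat) \<Rightarrow> (nat \<Rightarrow> real) \<Rightarrow> nat \<Rightarrow> real" where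
  "simplex_push m \<theta> t = (\<lambda>i. \<Sum>j\<in>{j. j \<le> m \<and> \<theta> j = i}. t j)"

definition realization_pre :: "'a sset \<Rightarrow> (nat \<times> 'a \<times> (nat \<Rightarrow> real)) set" where
  "realization_pre X = {(n, x, t). x \<in> simplices X n \<and> t \<in> standard_simplex n}"

definition realization_gen ::
  "'a sset \<Rightarrow> ((nat \<times> 'a \<times> (nat \<Rightarrow> real)) \<times> (nat \<times> 'a \<times> (nat \<Rightarrow> real))) set" where
  "realization_gen X =
    {((m, act X m n \<theta> x, t), (n, x, simplex_push m \<theta> t)) | m n \<theta> x t.
       \<theta> \<in> Delta_hom m n \<and> x \<in> simplices X n \<and> t \<in> standard_simplex m}"

definition realization_rel ::
  "'a sset \<Rightarrow> ((nat \<times> 'a \<times> (nat \<Rightarrow> real)) \<times> (nat \<times> 'a \<times> (nat \<Rightarrow> real))) set" where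
  "realization_rel X =
    (realization_gen X \<union> (realization_gen X)\<inverse>)\<^sup>* \<inter> realization_pre X \<times> realization_pre X"

text \<open>The quotient topology from the disjoint union of one topological \<open>n\<close>-simplex for each
  \<open>x \<in> X\<^sub>n\<close>.\<close>

definition realization :: "'a sset \<Rightarrow> (nat \<times> 'a \<times> (nat \<Rightarrow> real)) set topology" where
  "realization X =
    topology (\<lambda>U. U \<subseteq> realization_pre X // realization_rel X \<and>
      (\<forall>n. \<forall>x\<in>simplices X n.
        openin (subtopology (powertop_real UNIV) (standard_simplex n))
          {t \<in> standard_simplex n. realization_rel X `` {(n, x, t)} \<in> U}))"

definition realization_map ::
  "'b sset \<Rightarrow> (nat \<Rightarrow> 'a \<Rightarrow> 'b) \<Rightarrow>
   (nat \<times> 'a \<times> (nat \<Rightarrow> real)) set \<Rightarrow> (nat \<times> 'b \<times> (nat \<Rightarrow> real)) set" where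
  "realization_map Y f c = realization_rel Y `` ((\<lambda>(n, x, t). (n, f n x, t)) ` c)"

definition sing :: "'t topology \<Rightarrow> ((nat \<Rightarrow> real) \<Rightarrow> 't) sset" where
  "sing T =
    \<lparr>simplices = (\<lambda>n. {\<sigma>. singular_simplex n T \<sigma>}),
     act = (\<lambda>m n \<theta> \<sigma>. restrict (\<sigma> \<circ> simplex_push m \<theta>) (standard_simplex m))\<rparr>"

text \<open>The functorial fibrant replacement of simplicial sets, \<open>X \<mapsto> Sing |X|\<close>.\<close>

type_synonym 'a fib = "(nat \<Rightarrow> real) \<Rightarrow> (nat \<times> 'a \<times> (nat \<Rightarrow> real)) set"

definition fib :: "'a sset \<Rightarrow> 'a fib sset" where
  "fib X = sing (realization X)"

definition fib_map ::
  "'a sset \<Rightarrow> 'b sset \<Rightarrow> (nat \<Rightarrow> 'a \<Rightarrow> 'b) \<Rightarrow> nat \<Rightarrow> 'a fib \<Rightarrow> 'b fib" where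
  "fib_map X Y f n =
    (\<lambda>\<sigma>\<in>simplices (fib X) n. restrict (realization_map Y f \<circ> \<sigma>) (standard_simplex n))"


section \<open>Homotopy limits\<close>

record ('o, 'm, 'a) diagram =
  ob :: "'o \<Rightarrow> 'a sset"
  mor :: "'o \<Rightarrow> 'o \<Rightarrow> 'm \<Rightarrow> nat \<Rightarrow> 'a \<Rightarrow> 'a"

definition fib_diagram :: "('o, 'm, 'a) diagram \<Rightarrow> ('o, 'm, 'a fib) diagram" where
  "fib_diagram X =
    \<lparr>ob = (\<lambda>c. fib (ob X c)), mor = (\<lambda>c d u. fib_map (ob X c) (ob X d) (mor X c d u))\<rparr>"

type_synonym ('o, 'm) over_simplex = "(nat \<Rightarrow> 'o \<times> 'm) \<times> (nat \<times> nat \<Rightarrow> 'm)"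

type_synonym ('o, 'm, 'a) nat_family = "'o \<Rightarrow> nat \<Rightarrow> ('o, 'm) over_simplex \<times> (nat \<Rightarrow> nat) \<Rightarrow> 'a"

text \<open>The Bousfield--Kan formula: the simplicial mapping space from the diagram
  \<open>c \<mapsto> N(C/c)\<close> to \<open>X\<close>.  Its \<open>k\<close>-simplices are the natural families of simplicial maps
  \<open>N(C/c) \<times> \<Delta>\<^sup>k \<rightarrow> X c\<close>.  It has the correct homotopy type if all \<open>X c\<close> are Kan complexes.\<close>

definition bk_holim ::
  "('o, 'm) small_cat \<Rightarrow> ('o, 'm, 'a) diagram \<Rightarrow> ('o, 'm, 'a) nat_family sset" where
  "bk_holim C X =
    \<lparr>simplices = (\<lambda>k.
       {F \<in> (\<Pi>\<^sub>E c\<in>Obj C. sset_hom (prod_sset (nerve (over_cat C c)) (std_simplex k)) (ob X c)).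
         \<forall>c\<in>Obj C. \<forall>d\<in>Obj C. \<forall>u\<in>Hom C c d. \<forall>n.
           \<forall>\<sigma>\<in>simplices (nerve (over_cat C c)) n. \<forall>\<tau>\<in>simplices (std_simplex k) n.
             F d n (over_nerve_map C c d u n \<sigma>, \<tau>) = mor X c d u n (F c n (\<sigma>, \<tau>))}),
     act = (\<lambda>k l \<theta> F. \<lambda>c\<in>Obj C. \<lambda>n.
       \<lambda>(\<sigma>, \<tau>)\<in>simplices (prod_sset (nerve (over_cat C c)) (std_simplex k)) n.
         F c n (\<sigma>, compose {..n} \<theta> \<tau>))\<rparr>"

text \<open>The homotopy invariant homotopy limit.\<close>

definition holim ::
  "('o, 'm) small_cat \<Rightarrow> ('o, 'm, 'a) diagram \<Rightarrow> ('o, 'm, 'a fib) nat_family sset" where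
  "holim C X = bk_holim C (fib_diagram X)"

text \<open>The map \<open>holim C X \<rightarrow> holim D X\<close> for a full subcategory \<open>D\<close> of \<open>C\<close>, by restriction along
  \<open>N(D/d) \<subseteq> N(C/d)\<close>.\<close>

definition holim_restrict ::
  "('o, 'm) small_cat \<Rightarrow> ('o, 'm) small_cat \<Rightarrow> ('o, 'm, 'a) diagram \<Rightarrow>
   nat \<Rightarrow> ('o, 'm, 'a fib) nat_family \<Rightarrow> ('o, 'm, 'a fib) nat_family" where
  "holim_restrict D C X k =
    (\<lambda>F\<in>simplices (holim C X) k. \<lambda>d\<in>Obj D. \<lambda>n.
       restrict (F d n) (simplices (prod_sset (nerve (over_cat D d)) (std_simplex k)) n))"


section \<open>Homotopy groups\<close>

definition coface :: "nat \<Rightarrow> nat \<Rightarrow> nat \<Rightarrow> nat" where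
  "coface n i = (\<lambda>j\<in>{..n}. if j < i then j else Suc j)"

definition face :: "'a sset \<Rightarrow> nat \<Rightarrow> nat \<Rightarrow> 'a \<Rightarrow> 'a" where
  "face K n i = act K n (Suc n) (coface n i)"

definition vertex_degen :: "'a sset \<Rightarrow> nat \<Rightarrow> 'a \<Rightarrow> 'a" where
  "vertex_degen K n v = act K n 0 (\<lambda>i\<in>{..n}. 0) v"

text \<open>The usual combinatorial description of the homotopy groups of a Kan complex \<open>K\<close>: the
  elements of \<open>\<pi>\<^sub>n(K, v)\<close> are represented by the \<open>n\<close>-simplices with boundary \<open>v\<close>, and
  \<open>[x] [y] = [d\<^sub>n w]\<close> for any \<open>(n+1)\<close>-simplex \<open>w\<close> with \<open>d\<^bsub>n-1\<^esub> w = x\<close>, \<open>d\<^bsub>n+1\<^esub> w = y\<close> and all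
  remaining faces other than \<open>d\<^sub>n w\<close> equal to \<open>v\<close>.  These definitions are meant for \<open>n \<ge> 1\<close>; the
  set \<open>\<pi>\<^sub>0\<close> is treated separately, without basepoint.\<close>

definition kan_spheres :: "'a sset \<Rightarrow> nat \<Rightarrow> 'a \<Rightarrow> 'a set" where
  "kan_spheres K n v =
    {x \<in> simplices K n. \<forall>i\<le>n. face K (n - 1) i x = vertex_degen K (n - 1) v}"

definition kan_homotopic :: "'a sset \<Rightarrow> nat \<Rightarrow> 'a \<Rightarrow> ('a \<times> 'a) set" where
  "kan_homotopic K n v =
    {(x, y). x \<in> kan_spheres K n v \<and> y \<in> kan_spheres K n v \<and>
       (\<exists>w\<in>simplices K (Suc n). (\<forall>i<n. face K n i w = vertex_degen K n v) \<and>
          face K n n w = x \<and> face K n (Suc n) w = y)}"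

definition kan_pi :: "'a sset \<Rightarrow> nat \<Rightarrow> 'a \<Rightarrow> 'a set monoid" where
  "kan_pi K n v =
    \<lparr>carrier = kan_spheres K n v // kan_homotopic K n v,
     mult = (\<lambda>P Q. {z. \<exists>x\<in>P. \<exists>y\<in>Q. \<exists>w\<in>simplices K (Suc n).
       (\<forall>i<n - 1. face K n i w = vertex_degen K n v) \<and>
       face K n (n - 1) w = x \<and> face K n (Suc n) w = y \<and>
       (face K n n w, z) \<in> kan_homotopic K n v}),
     one = kan_homotopic K n v `` {vertex_degen K n v}\<rparr>"

definition kan_pi0_rel :: "'a sset \<Rightarrow> ('a \<times> 'a) set" where
  "kan_pi0_rel K = {(x, y). \<exists>w\<in>simplices K 1. face K 0 0 w = x \<and> face K 0 1 w = y}"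

text \<open>Homotopy groups of an arbitrary simplicial set \<open>X\<close> are those of the Kan complex
  \<open>Sing |X|\<close>; \<open>\<pi>\<^sub>n\<close> with \<open>n \<ge> 1\<close> is based at a vertex \<open>v\<close> of \<open>Sing |X|\<close>, that is, a point
  of \<open>|X|\<close>.\<close>

definition pi0 :: "'a sset \<Rightarrow> 'a fib set set" where
  "pi0 X = simplices (fib X) 0 // kan_pi0_rel (fib X)"

definition pi0_map :: "'a sset \<Rightarrow> 'b sset \<Rightarrow> (nat \<Rightarrow> 'a \<Rightarrow> 'b) \<Rightarrow> 'a fib set \<Rightarrow> 'b fib set" where
  "pi0_map X Y f P = kan_pi0_rel (fib Y) `` (fib_map X Y f 0 ` P)"

definition pi_group :: "'a sset \<Rightarrow> nat \<Rightarrow> 'a fib \<Rightarrow> 'a fib set monoid" where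
  "pi_group X n v = kan_pi (fib X) n v"

definition pi_map ::
  "'a sset \<Rightarrow> 'b sset \<Rightarrow> (nat \<Rightarrow> 'a \<Rightarrow> 'b) \<Rightarrow> nat \<Rightarrow> 'a fib \<Rightarrow> 'a fib set \<Rightarrow> 'b fib set" where
  "pi_map X Y f n v P = kan_homotopic (fib Y) n (fib_map X Y f 0 v) `` (fib_map X Y f n ` P)"


section \<open>Towers and pro-equivalences\<close>

text \<open>\<open>bond A s t\<close> is the structure map from stage \<open>t\<close> to stage \<open>s \<le> t\<close>.\<close>

record 'a tower =
  stage :: "nat \<Rightarrow> 'a sset"
  bond :: "nat \<Rightarrow> nat \<Rightarrow> nat \<Rightarrow> 'a \<Rightarrow> 'a"

definition is_tower :: "'a tower \<Rightarrow> bool" where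
  "is_tower A \<longleftrightarrow>
    (\<forall>s. is_sset (stage A s)) \<and>
    (\<forall>s t. s \<le> t \<longrightarrow> bond A s t \<in> sset_hom (stage A t) (stage A s)) \<and>
    (\<forall>s n. \<forall>x\<in>simplices (stage A s) n. bond A s s n x = x) \<and>
    (\<forall>r s t n. r \<le> s \<longrightarrow> s \<le> t \<longrightarrow>
       (\<forall>x\<in>simplices (stage A t) n. bond A r s n (bond A s t n x) = bond A r t n x))"

definition tower_map :: "'a tower \<Rightarrow> 'b tower \<Rightarrow> (nat \<Rightarrow> nat \<Rightarrow> 'a \<Rightarrow> 'b) \<Rightarrow> bool" where
  "tower_map A B f \<longleftrightarrow>
    (\<forall>s. f s \<in> sset_hom (stage A s) (stage B s)) \<and>
    (\<forall>s t n. s \<le> t \<longrightarrow>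
       (\<forall>x\<in>simplices (stage A t) n. f s n (bond A s t n x) = bond B s t n (f t n x)))"

text \<open>\<open>h\<close> is a diagonal \<open>B' \<rightarrow> A\<close> making both triangles commute in the square with
  \<open>f' : A' \<rightarrow> B'\<close>, \<open>f : A \<rightarrow> B\<close>, \<open>p : A' \<rightarrow> A\<close>, \<open>q : B' \<rightarrow> B\<close>.\<close>

definition square_diagonal ::
  "'x set \<Rightarrow> 'y set \<Rightarrow> ('x \<Rightarrow> 'y) \<Rightarrow> ('u \<Rightarrow> 'v) \<Rightarrow> ('x \<Rightarrow> 'u) \<Rightarrow> ('y \<Rightarrow> 'v) \<Rightarrow> ('y \<Rightarrow> 'u) \<Rightarrow> bool" where
  "square_diagonal A' B' f' f p q h \<longleftrightarrow> (\<forall>x\<in>A'. h (f' x) = p x) \<and> (\<forall>y\<in>B'. f (h y) = q y)"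

definition pi0_pro_iso :: "'a tower \<Rightarrow> 'b tower \<Rightarrow> (nat \<Rightarrow> nat \<Rightarrow> 'a \<Rightarrow> 'b) \<Rightarrow> bool" where
  "pi0_pro_iso A B f \<longleftrightarrow>
    (\<forall>s. \<exists>t. \<exists>h\<in>pi0 (stage B (s + t)) \<rightarrow> pi0 (stage A s).
       square_diagonal (pi0 (stage A (s + t))) (pi0 (stage B (s + t)))
         (pi0_map (stage A (s + t)) (stage B (s + t)) (f (s + t)))
         (pi0_map (stage A s) (stage B s) (f s))
         (pi0_map (stage A (s + t)) (stage A s) (bond A s (s + t)))
         (pi0_map (stage B (s + t)) (stage B s) (bond B s (s + t))) h)"

text \<open>The stages of a tower are unpointed and the tower need not have any compatible system of
  basepoints (its limit may be empty), so the pro-isomorphism condition on \<open>\<pi>\<^sub>n\<close> is imposed at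
  every basepoint \<open>v\<close> of the stage \<open>s + t\<close>, with \<open>t\<close> depending on \<open>n\<close> and \<open>s\<close> but not on
  \<open>v\<close>.\<close>

definition pi_pro_iso :: "nat \<Rightarrow> 'a tower \<Rightarrow> 'b tower \<Rightarrow> (nat \<Rightarrow> nat \<Rightarrow> 'a \<Rightarrow> 'b) \<Rightarrow> bool" where
  "pi_pro_iso n A B f \<longleftrightarrow>
    (\<forall>s. \<exists>t. \<forall>v\<in>simplices (fib (stage A (s + t))) 0.
       let v' = fib_map (stage A (s + t)) (stage B (s + t)) (f (s + t)) 0 v;
           w = fib_map (stage A (s + t)) (stage A s) (bond A s (s + t)) 0 v
       in \<exists>h\<in>hom (pi_group (stage B (s + t)) n v') (pi_group (stage A s) n w).
         square_diagonal
           (carrier (pi_group (stage A (s + t)) n v)) (carrier (pi_group (stage B (s + t)) n v'))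
           (pi_map (stage A (s + t)) (stage B (s + t)) (f (s + t)) n v)
           (pi_map (stage A s) (stage B s) (f s) n w)
           (pi_map (stage A (s + t)) (stage A s) (bond A s (s + t)) n v)
           (pi_map (stage B (s + t)) (stage B s) (bond B s (s + t)) n v') h)"

definition weak_pro_equivalence :: "'a tower \<Rightarrow> 'b tower \<Rightarrow> (nat \<Rightarrow> nat \<Rightarrow> 'a \<Rightarrow> 'b) \<Rightarrow> bool" where
  "weak_pro_equivalence A B f \<longleftrightarrow>
    is_tower A \<and> is_tower B \<and> tower_map A B f \<and>
    pi0_pro_iso A B f \<and> (\<forall>n\<ge>1. pi_pro_iso n A B f)"

text \<open>Two towers are pro-equivalent if they are connected by a zigzag of weak pro-homotopy
  equivalences.\<close>

definition pro_equivalent_towers :: "'a tower \<Rightarrow> 'a tower \<Rightarrow> bool" where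
  "pro_equivalent_towers = equivclp (\<lambda>A B. \<exists>f. weak_pro_equivalence A B f)"


section \<open>Cosimplicial simplicial sets\<close>

type_synonym 'a cosimplicial = "(nat, nat \<Rightarrow> nat, 'a) diagram"

definition Tot :: "nat \<Rightarrow> 'a cosimplicial \<Rightarrow> (nat, nat \<Rightarrow> nat, 'a fib) nat_family sset" where
  "Tot r X = holim (Delta_trunc r) X"

definition Tot_tower :: "'a cosimplicial \<Rightarrow> (nat, nat \<Rightarrow> nat, 'a fib) nat_family tower" where
  "Tot_tower X =
    \<lparr>stage = (\<lambda>r. Tot r X),
     bond = (\<lambda>r s. holim_restrict (Delta_trunc r) (Delta_trunc s) X)\<rparr>"

definition pro_equivalent :: "'a cosimplicial \<Rightarrow> 'a cosimplicial \<Rightarrow> bool" where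
  "pro_equivalent X Y \<longleftrightarrow> pro_equivalent_towers (Tot_tower X) (Tot_tower Y)"

definition const_cosimplicial :: "'a sset \<Rightarrow> 'a cosimplicial" where
  "const_cosimplicial K =
    \<lparr>ob = (\<lambda>p. K), mor = (\<lambda>p q u k. restrict (\<lambda>x. x) (simplices K k))\<rparr>"

definition std_cosimplicial :: "(nat \<Rightarrow> nat) cosimplicial" where
  "std_cosimplicial =
    \<lparr>ob = std_simplex, mor = (\<lambda>p q u k. \<lambda>x\<in>simplices (std_simplex p) k. compose {..k} u x)\<rparr>"

definition sk :: "nat \<Rightarrow> 'a cosimplicial \<Rightarrow> 'a cosimplicial" where
  "sk n X =
    \<lparr>ob = (\<lambda>p. skeleton n (ob X p)),
     mor = (\<lambda>p q u k. restrict (mor X p q u k) (simplices (skeleton n (ob X p)) k))\<rparr>"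

end

theory Submission
  imports Defs "HOL-Combinatorics.Permutations"
begin

text \<open>A simplex of \<open>Tot k\<close> of the cosimplicial \<open>n\<close>-skeleton gives, by evaluation at a vertex, maps from
  the nerves of the categories over \<open>[p]\<close>, for \<open>p \<le> k\<close>, to the singular complexes of the
  realizations of the \<open>n\<close>-skeleta of the \<open>p\<close>-simplices, natural in \<open>[p]\<close>.  Let \<open>k \<ge> n + 1\<close> and take
  \<open>p = n + 1\<close>: the skeleton is then the boundary of the simplex.  The nerve over \<open>[n + 1]\<close> contains the
  barycentric subdivision of the \<open>(n + 1)\<close>-simplex, whose simplices are the flags of nonempty subsets of
  \<open>[n + 1]\<close>; so every flag is assigned a singular simplex in the boundary of the topological
  \<open>(n + 1)\<close>-simplex, compatibly with faces.  Naturality for the injection onto a subset \<open>S\<close> forces flags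
  of subsets of \<open>S\<close> to be sent into the face spanned by \<open>S\<close>.  Altogether this amounts to a map from
  the \<open>(n + 1)\<close>-simplex to its own boundary that carries every face into itself, contradicting
  Brouwer's theorem (\<open>Tot_skeleton_empty\<close>).

  The contradiction is derived in \<open>no_flag_system_in_simplex_boundary\<close> by running Sperner's argument on
  singular chains instead of on a triangulation: points are labelled by a vertex with large barycentric
  coordinate, fully labelled simplices are counted modulo 2, and the boundary formula for chains plays
  the role of the double count of facets.  Iterated barycentric subdivision commutes with the boundary
  and makes the simplices small, and a small simplex in the boundary of the topological simplex cannot
  carry all labels.

  The stages of the Tot tower of the constant object with value the empty set are all empty, and those
  of the skeleton are empty from stage \<open>n + 1\<close> on.  Therefore the unique map from the former tower to
  the latter is a weak pro-homotopy equivalence, all the sets that would have to be compared being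
  empty from stage \<open>n + 1\<close> on (\<open>weak_pro_equivalence_from_empty\<close>).  This uses that Tot towers are towers
  of simplicial sets, also at the early stages, which is the formal verification in
  \<open>is_tower_Tot_tower\<close>.\<close>

section \<open>Counting fully labelled singular simplices\<close>

text \<open>The combinatorial heart of Sperner's lemma.  If the labels of the \<open>p + 2\<close> vertices exhaust
  \<open>{..Suc p}\<close>, the only facet labelled by \<open>{..p}\<close> is the one opposite the vertex labelled \<open>Suc p\<close>.
  If they do not, but some facet is labelled by \<open>{..p}\<close>, then exactly two vertices share a label,
  and the facets opposite these two vertices are the ones labelled by \<open>{..p}\<close>.\<close>

lemma complete_facets_parity:
  fixes a :: "nat \<Rightarrow> nat"
  assumes lab: "a ` {..Suc p} \<subseteq> {..Suc p}"
  shows "odd (card {k. k \<le> Suc p \<and> a ` ({..Suc p} - {k}) = {..p}}) \<longleftrightarrow> a ` {..Suc p} = {..Suc p}"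
proof (cases "a ` {..Suc p} = {..Suc p}")
  case True
  then have inj: "inj_on a {..Suc p}"
    by (simp add: eq_card_imp_inj_on)
  obtain m where m: "m \<le> Suc p" "a m = Suc p"
    using True by (metis atMost_iff imageE order_refl)
  have "a ` ({..Suc p} - {k}) = {..Suc p} - {a k}" if "k \<le> Suc p" for k
    using inj that True by (simp add: inj_on_image_set_diff[of a "{..Suc p}"])
  moreover have "{..Suc p} - {x} = {..p} \<longleftrightarrow> x = Suc p" if "x \<le> Suc p" for x
    using that by (auto simp: set_eq_iff le_Suc_eq)
  ultimately have "k \<le> Suc p \<and> a ` ({..Suc p} - {k}) = {..p} \<longleftrightarrow> k \<le> Suc p \<and> a k = Suc p" for k
    using lab by (metis (no_types, lifting) atMost_iff image_subset_iff)
  moreover have "k \<le> Suc p \<and> a k = Suc p \<longleftrightarrow> k = m" for k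
    using m inj by (metis atMost_iff inj_onD)
  ultimately have "{k. k \<le> Suc p \<and> a ` ({..Suc p} - {k}) = {..p}} = {m}"
    by auto
  then show ?thesis using True by simp
next
  case False
  show ?thesis
  proof (cases "{k. k \<le> Suc p \<and> a ` ({..Suc p} - {k}) = {..p}} = {}")
    case True
    with False show ?thesis by (metis card.empty even_zero)
  next
    case ne: False
    then obtain k where k: "k \<le> Suc p" "a ` ({..Suc p} - {k}) = {..p}" by auto
    have ins: "a ` {..Suc p} = insert (a k) {..p}"
      using k by (metis atMost_iff image_insert insert_Diff)
    have ak: "a k \<le> p"
    proof (rule ccontr)
      assume "\<not> a k \<le> p"
      moreover have "a k \<le> Suc p" using lab k by auto
      ultimately have "a k = Suc p" by simp
      with ins False show False by (simp add: atMost_Suc)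
    qed
    have full: "a ` {..Suc p} = {..p}" using ins ak by auto
    have card_k: "card ({..Suc p} - {k}) = Suc p" using k by simp
    have inj: "inj_on a ({..Suc p} - {k})"
      by (rule eq_card_imp_inj_on) (use k card_k in auto)
    obtain m where m: "m \<in> {..Suc p} - {k}" "a m = a k"
      using ak k(2) by (metis atMost_iff imageE)
    have iff: "j \<le> Suc p \<and> a ` ({..Suc p} - {j}) = {..p} \<longleftrightarrow> j = k \<or> j = m" for j
    proof
      assume j: "j \<le> Suc p \<and> a ` ({..Suc p} - {j}) = {..p}"
      show "j = k \<or> j = m"
      proof (rule ccontr)
        assume n: "\<not> (j = k \<or> j = m)"
        have "a j \<in> a ` {..Suc p}" using j by blast
        then have "a j \<in> a ` ({..Suc p} - {j})" using j full by simp
        then obtain i where "i \<in> {..Suc p} - {j}" "a j = a i" by (rule imageE)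
        then have i: "i \<le> Suc p" "i \<noteq> j" "a i = a j" by auto
        show False
        proof (cases "i = k")
          case True
          then have "a m = a j" using i m by simp
          then show False using inj m n j by (auto dest: inj_onD)
        next
          case False
          then show False using inj i n j by (auto dest: inj_onD)
        qed
      qed
    next
      assume "j = k \<or> j = m"
      then show "j \<le> Suc p \<and> a ` ({..Suc p} - {j}) = {..p}"
      proof
        assume "j = k" then show ?thesis using k by simp
      next
        assume j: "j = m"
        have "a ` ({..Suc p} - {m}) = a ` {..Suc p}"
        proof
          show "a ` {..Suc p} \<subseteq> a ` ({..Suc p} - {m})"
          proof
            fix y assume "y \<in> a ` {..Suc p}"
            then obtain i where "i \<le> Suc p" "y = a i" by auto
            then show "y \<in> a ` ({..Suc p} - {m})"
              using m k by (cases "i = m") auto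
          qed
        qed auto
        then show ?thesis using j m full by simp
      qed
    qed
    have "{j. j \<le> Suc p \<and> a ` ({..Suc p} - {j}) = {..p}} = {k, m}"
      by (simp only: iff) auto
    then have "card {j. j \<le> Suc p \<and> a ` ({..Suc p} - {j}) = {..p}} = 2"
      using m by simp
    then show ?thesis using False by simp
  qed
qed

definition skip :: "nat \<Rightarrow> nat \<Rightarrow> nat" where
  "skip k j = (if j < k then j else Suc j)"

definition corner :: "nat \<Rightarrow> nat \<Rightarrow> real" where
  "corner j = (\<lambda>i. if i = j then 1 else 0)"

definition fully_labelled :: "('a \<Rightarrow> nat) \<Rightarrow> nat \<Rightarrow> ((nat \<Rightarrow> real) \<Rightarrow> 'a) \<Rightarrow> bool" where
  "fully_labelled l p \<sigma> \<longleftrightarrow> (\<lambda>j. l (\<sigma> (corner j))) ` {..p} = {..p}"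

text \<open>The additive extension to chains of the indicator function of the fully labelled simplices;
  chains on a one-element type serve as the integers, so that the additivity of the extension
  operator of free abelian groups applies.\<close>

definition sperner_count :: "('a \<Rightarrow> nat) \<Rightarrow> nat \<Rightarrow> 'a chain \<Rightarrow> int" where
  "sperner_count l p c =
    Poly_Mapping.lookup (frag_extend (\<lambda>\<sigma>. if fully_labelled l p \<sigma> then frag_of () else 0) c) ()"

lemma sperner_count_0 [simp]: "sperner_count l p 0 = 0"
  by (simp add: sperner_count_def)

lemma sperner_count_of [simp]:
  "sperner_count l p (frag_of \<sigma>) = of_bool (fully_labelled l p \<sigma>)"
  by (simp add: sperner_count_def)

lemma sperner_count_cmul [simp]:
  "sperner_count l p (frag_cmul k c) = k * sperner_count l p c"
  by (simp add: sperner_count_def frag_extend_cmul)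

lemma sperner_count_diff:
  "sperner_count l p (a - b) = sperner_count l p a - sperner_count l p b"
  by (simp add: sperner_count_def frag_extend_diff lookup_minus)

lemma sperner_count_add:
  "sperner_count l p (a + b) = sperner_count l p a + sperner_count l p b"
  by (simp add: sperner_count_def frag_extend_add lookup_add)

lemma sperner_count_sum:
  "sperner_count l p (sum f I) = (\<Sum>i\<in>I. sperner_count l p (f i))"
  by (induction I rule: infinite_finite_induct) (simp_all add: sperner_count_add)

lemma sperner_count_eq_0:
  assumes "\<And>\<sigma>. \<sigma> \<in> Poly_Mapping.keys c \<Longrightarrow> \<not> fully_labelled l p \<sigma>"
  shows "sperner_count l p c = 0"
  unfolding sperner_count_def by (subst frag_extend_eq_0) (use assms in auto)

lemma corner_in_standard_simplex [simp]: "corner j \<in> standard_simplex p \<longleftrightarrow> j \<le> p"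
  by (simp add: corner_def)

lemma singular_face_corner:
  assumes "j \<le> p"
  shows "singular_face (Suc p) k \<sigma> (corner j) = \<sigma> (corner (skip k j))"
proof -
  have "simplical_face k (corner j) = corner (skip k j)"
    by (auto simp: skip_def simplical_face_def corner_def fun_eq_iff)
  then show ?thesis using assms by (simp add: singular_face_def)
qed

lemma skip_image:
  assumes "k \<le> Suc p"
  shows "skip k ` {..p} = {..Suc p} - {k}"
proof
  show "{..Suc p} - {k} \<subseteq> skip k ` {..p}"
  proof
    fix x assume x: "x \<in> {..Suc p} - {k}"
    then show "x \<in> skip k ` {..p}"
      using assms by (intro image_eqI[of _ _ "if x < k then x else x - 1"]) (auto simp: skip_def)
  qed
qed (auto simp: skip_def)

lemma fully_labelled_face:
  assumes "k \<le> Suc p"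
  shows "fully_labelled l p (singular_face (Suc p) k \<sigma>) \<longleftrightarrow>
    (\<lambda>j. l (\<sigma> (corner j))) ` ({..Suc p} - {k}) = {..p}"
proof -
  have "(\<lambda>j. l (singular_face (Suc p) k \<sigma> (corner j))) ` {..p} =
     (\<lambda>j. l (\<sigma> (corner j))) ` skip k ` {..p}"
    unfolding image_image by (rule image_cong) (simp_all add: singular_face_corner)
  then show ?thesis using assms by (simp only: fully_labelled_def skip_image)
qed

lemma sperner_count_boundary_simplex:
  assumes "\<And>j. j \<le> Suc p \<Longrightarrow> l (\<sigma> (corner j)) \<le> Suc p"
  shows "even (sperner_count l p (chain_boundary (Suc p) (frag_of \<sigma>)) -
               sperner_count l (Suc p) (frag_of \<sigma>))"
proof -
  define F where "F k = fully_labelled l p (singular_face (Suc p) k \<sigma>)" for k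
  define A where "A = {k. k \<le> Suc p \<and> (\<lambda>j. l (\<sigma> (corner j))) ` ({..Suc p} - {k}) = {..p}}"
  have "sperner_count l p (chain_boundary (Suc p) (frag_of \<sigma>)) =
      (\<Sum>k\<le>Suc p. (-1) ^ k * of_bool (F k))"
    by (simp only: chain_boundary_of sperner_count_sum sperner_count_cmul sperner_count_of
        nat.distinct if_False F_def)
  moreover have "even ((\<Sum>k\<le>Suc p. (-1) ^ k * of_bool (F k)) - (\<Sum>k\<le>Suc p. of_bool (F k) :: int))"
    unfolding sum_subtractf[symmetric] by (rule dvd_sum) auto
  moreover have "(\<Sum>k\<le>Suc p. of_bool (F k) :: int) = int (card A)"
  proof -
    have "{..Suc p} \<inter> Collect F = {k. k \<le> Suc p \<and> F k}" by auto
    also have "\<dots> = A"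
      unfolding A_def F_def by (rule Collect_cong) (use fully_labelled_face in blast)
    finally have "{..Suc p} \<inter> Collect F = A" .
    then show ?thesis by (simp del: sum.atMost_Suc add: sum_of_bool_eq)
  qed
  moreover have "odd (card A) \<longleftrightarrow> fully_labelled l (Suc p) \<sigma>"
    unfolding fully_labelled_def A_def by (rule complete_facets_parity) (use assms in auto)
  ultimately show ?thesis
    by (simp only: sperner_count_of) (auto simp: even_diff_iff simp del: sum.atMost_Suc)
qed

text \<open>Modulo 2 the signs in the boundary of a chain disappear, so Sperner's lemma turns into the
  statement that counting \<open>{..p}\<close>-labelled facets counts \<open>{..Suc p}\<close>-labelled simplices.\<close>

lemma sperner_count_boundary:
  assumes c: "singular_chain (Suc p) X c"
    and l: "\<And>x. x \<in> topspace X \<Longrightarrow> l x \<le> Suc p"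
  shows "even (sperner_count l p (chain_boundary (Suc p) c) - sperner_count l (Suc p) c)"
  using c unfolding singular_chain_def
proof (induction rule: frag_induction)
  case zero
  then show ?case by simp
next
  case (one \<sigma>)
  then have "\<sigma> x \<in> topspace X" if "x \<in> standard_simplex (Suc p)" for x
    using that by (auto simp: singular_simplex_def continuous_map_def)
  then show ?case by (intro sperner_count_boundary_simplex l) simp
next
  case (diff a b)
  then show ?case
    by (auto simp: chain_boundary_diff sperner_count_diff even_diff_iff)
qed

section \<open>Iterated barycentric subdivision of chains\<close>

abbreviation iterated_subdivision :: "nat \<Rightarrow> nat \<Rightarrow> 'a chain \<Rightarrow> 'a chain" where
  "iterated_subdivision m p \<equiv> singular_subdivision p ^^ m"

lemma iterated_subdivision_sum:
  "iterated_subdivision m p (sum f I) = (\<Sum>i\<in>I. iterated_subdivision m p (f i))"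
proof -
  have add: "iterated_subdivision m p (a + b) = iterated_subdivision m p a + iterated_subdivision m p b"
    for a b :: "'a chain"
    by (induction m) (simp_all add: singular_subdivision_add)
  show ?thesis
    by (induction I rule: infinite_finite_induct) (simp_all add: add)
qed

lemma iterated_subdivision_minus:
  "iterated_subdivision m p (- a) = - iterated_subdivision m p a"
  using singular_subdivision_power_diff[of m p 0 a] by simp

lemma singular_chain_iterated_subdivision:
  "singular_chain p X c \<Longrightarrow> singular_chain p X (iterated_subdivision m p c)"
  by (induction m) (simp_all add: singular_chain_singular_subdivision)

lemma chain_boundary_iterated_subdivision:
  assumes "singular_chain p X c"
  shows "chain_boundary p (iterated_subdivision m p c) =
         iterated_subdivision m (p - Suc 0) (chain_boundary p c)"
  by (induction m)
    (simp_all add: chain_boundary_singular_subdivision[OF singular_chain_iterated_subdivision[OF assms]])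

lemma iterated_subdivision_0: "singular_chain 0 X c \<Longrightarrow> iterated_subdivision m 0 c = c"
  by (induction m) (auto simp: singular_subdivision_zero)

section \<open>Flags of vertex sets and the boundary of a simplex\<close>

text \<open>Composition with the transposition pairs off the permutations, so every value of \<open>h\<close> is taken
  an even number of times.  The pairs are separated by whether \<open>\<pi> i < \<pi> j\<close>.\<close>

lemma even_sum_permutations:
  fixes h :: "(nat \<Rightarrow> nat) \<Rightarrow> int"
  assumes ij: "i \<in> S" "j \<in> S" "i \<noteq> j" and "finite S"
    and h: "\<And>\<pi>. \<pi> permutes S \<Longrightarrow> h (\<pi> \<circ> Transposition.transpose i j) = h \<pi>"
  shows "even (\<Sum>\<pi> | \<pi> permutes S. h \<pi>)"
proof -
  let ?P = "{\<pi>. \<pi> permutes S}"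
  let ?t = "\<lambda>\<pi>. \<pi> \<circ> Transposition.transpose i j"
  let ?A = "{\<pi> \<in> ?P. \<pi> i < \<pi> j}" and ?B = "{\<pi> \<in> ?P. \<pi> j < \<pi> i}"
  have fin: "finite ?P" using \<open>finite S\<close> by (rule finite_permutations)
  have tr: "\<pi> \<circ> Transposition.transpose i j permutes S" if "\<pi> permutes S" for \<pi>
    using that ij by (simp add: permutes_compose permutes_swap_id)
  have "\<pi> i \<noteq> \<pi> j" if "\<pi> permutes S" for \<pi>
    using ij(3) permutes_inj[OF that] by (simp add: inj_eq)
  then have "?P = ?A \<union> ?B" by (auto simp: neq_iff)
  then have "sum h ?P = sum h (?A \<union> ?B)" by (rule arg_cong)
  also have "\<dots> = sum h ?A + sum h ?B"
  proof (rule sum.union_disjoint)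
    show "finite ?A" "finite ?B" using fin by auto
    show "?A \<inter> ?B = {}" by fastforce
  qed
  also have "sum h ?B = sum h ?A"
  proof (rule sum.reindex_bij_witness[where i = ?t and j = ?t])
    fix \<pi> assume "\<pi> \<in> ?B"
    then show "?t (?t \<pi>) = \<pi>" "?t \<pi> \<in> ?A" "h (?t \<pi>) = h \<pi>"
      by (simp_all add: tr h comp_assoc)
  next
    fix \<pi> assume "\<pi> \<in> ?A"
    then show "?t (?t \<pi>) = \<pi>" "?t \<pi> \<in> ?B"
      by (simp_all add: tr comp_assoc)
  qed
  finally show ?thesis by simp
qed

text \<open>The flags \<open>B 0 \<subseteq> \<dots> \<subseteq> B q\<close> are the \<open>q\<close>-simplices of the barycentric subdivision of the simplex
  with vertices \<open>{..N}\<close>.\<close>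

definition flag :: "nat \<Rightarrow> nat \<Rightarrow> (nat \<Rightarrow> nat set) \<Rightarrow> bool" where
  "flag N q B \<longleftrightarrow> (\<forall>i\<le>q. B i \<noteq> {} \<and> B i \<subseteq> {..N}) \<and> (\<forall>i j. i \<le> j \<and> j \<le> q \<longrightarrow> B i \<subseteq> B j)"

text \<open>For \<open>\<pi>\<close> permuting \<open>{..p}\<close>, these are the top-dimensional simplices of the subdivision of the
  simplex with vertices \<open>{..p}\<close>.\<close>

definition perm_flag :: "(nat \<Rightarrow> nat) \<Rightarrow> nat \<Rightarrow> nat set" where
  "perm_flag \<pi> j = \<pi> ` {..j}"

definition simplex_boundary :: "nat \<Rightarrow> (nat \<Rightarrow> real) topology" where
  "simplex_boundary N =
    subtopology (powertop_real UNIV) {x \<in> standard_simplex N. \<exists>i\<le>N. x i = 0}"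

lemma flag_perm_flag:
  assumes "\<pi> permutes {..p}" "p \<le> N" "q \<le> p"
  shows "flag N q (perm_flag \<pi>)"
proof -
  have "perm_flag \<pi> i \<subseteq> {..N}" if "i \<le> q" for i
  proof -
    have "perm_flag \<pi> i \<subseteq> \<pi> ` {..p}" using that assms(3) by (auto simp: perm_flag_def)
    also have "\<dots> = {..p}" by (rule permutes_image[OF assms(1)])
    also have "\<dots> \<subseteq> {..N}" using assms(2) by auto
    finally show ?thesis .
  qed
  then show ?thesis by (auto simp: flag_def perm_flag_def)
qed

lemma flag_skip:
  assumes "flag N (Suc q) B" shows "flag N q (B \<circ> skip k)"
  using assms by (auto simp: flag_def skip_def)

text \<open>A system \<open>g\<close> as below would glue to a continuous map from the simplex with vertices \<open>{..N}\<close> to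
  its boundary which maps every face into itself.  Sperner's argument excludes it without any
  glueing.  Let \<open>c p\<close> be the sum of the singular simplices \<open>g p (perm_flag \<pi>)\<close> over the permutations
  \<open>\<pi>\<close> of \<open>{..p}\<close>; it is the image of the subdivided face with vertices \<open>{..p}\<close>.  Label a point by a
  vertex at which its barycentric coordinate is large.  In the boundary of \<open>c (Suc p)\<close> the facets
  interior to the subdivision cancel modulo 2; an outer facet lies in a proper face of \<open>{..Suc p}\<close>,
  so it can carry all labels in \<open>{..p}\<close> only if that face is \<open>{..p}\<close>, and these facets make up \<open>c p\<close>.
  By induction every subdivision of \<open>c p\<close> has an odd number of fully labelled simplices.  For
  \<open>p = N\<close> this fails after enough subdivisions, because a small simplex in the boundary stays away
  from some vertex.\<close>

lemma no_flag_system_in_simplex_boundary: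
  fixes g :: "nat \<Rightarrow> (nat \<Rightarrow> nat set) \<Rightarrow> (nat \<Rightarrow> real) \<Rightarrow> nat \<Rightarrow> real"
  assumes simplex: "\<And>q B. flag N q B \<Longrightarrow> singular_simplex q (simplex_boundary N) (g q B)"
    and supp: "\<And>q B x i. flag N q B \<Longrightarrow> x \<in> standard_simplex q \<Longrightarrow> i \<notin> B q \<Longrightarrow> g q B x i = 0"
    and face: "\<And>q B k. flag N (Suc q) B \<Longrightarrow> k \<le> Suc q \<Longrightarrow>
                 singular_face (Suc q) k (g (Suc q) B) = g q (B \<circ> skip k)"
    and cong: "\<And>q B B'. (\<And>i. i \<le> q \<Longrightarrow> B i = B' i) \<Longrightarrow> g q B = g q B'"
  shows False
proof -
  define X where "X = simplex_boundary N"
  have topX: "topspace X = {x \<in> standard_simplex N. \<exists>i\<le>N. x i = 0}"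
    by (simp add: X_def simplex_boundary_def)
  \<comment> \<open>The largest of \<open>N + 1\<close> barycentric coordinates is at least their average \<open>1 / (N + 1)\<close>.\<close>
  define l where "l x = (SOME i. i \<le> N \<and> x i \<ge> 1 / (real N + 1))" for x :: "nat \<Rightarrow> real"
  have l: "l x \<le> N \<and> x (l x) \<ge> 1 / (real N + 1)" if "x \<in> standard_simplex N" for x
    unfolding l_def
  proof (rule someI_ex, rule ccontr)
    assume "\<nexists>i. i \<le> N \<and> x i \<ge> 1 / (real N + 1)"
    then have "x i < 1 / (real N + 1)" if "i \<in> {..N}" for i using that by (meson atMost_iff not_le)
    then have "sum x {..N} < (\<Sum>i\<le>N. 1 / (real N + 1))"
      by (intro sum_strict_mono) auto
    also have "\<dots> = 1" by (simp add: field_simps)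
    finally show False using that by (simp add: standard_simplex_def)
  qed
  have l_supp: "x (l x) \<noteq> 0" if "x \<in> standard_simplex N" for x
  proof -
    have "0 < 1 / (real N + 1)" by simp
    then show ?thesis using l[OF that] by linarith
  qed
  define c where "c p = (\<Sum>\<pi> | \<pi> permutes {..p}. frag_of (g p (perm_flag \<pi>)))" for p
  have fin: "finite {\<pi>. \<pi> permutes {..p}}" for p :: nat by (simp add: finite_permutations)
  have cX: "singular_chain p X (c p)" if "p \<le> N" for p
    unfolding c_def X_def
    by (intro singular_chain_sum) (auto simp: singular_chain_of intro!: simplex flag_perm_flag that)
  \<comment> \<open>No point of \<open>U i\<close> is labelled \<open>i\<close>, and the \<open>U i\<close> cover the boundary since some coordinate vanishes.\<close>
  define U where "U i = {x \<in> topspace X. x i < 1 / (real N + 1)}" for i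
  obtain m0 where m0: "\<And>m f. \<lbrakk>m0 \<le> m; f \<in> Poly_Mapping.keys (iterated_subdivision m N (c N))\<rbrakk>
       \<Longrightarrow> \<exists>V \<in> U ` {..N}. f \<in> standard_simplex N \<rightarrow> V"
  proof (rule sufficient_iterated_singular_subdivision_exists[of "U ` {..N}" X N "c N"])
    show "openin X V" if VU: "V \<in> U ` {..N}" for V
    proof -
      obtain i where V: "V = U i" using VU by auto
      have "continuous_map X euclideanreal (\<lambda>x. x i)"
        unfolding X_def simplex_boundary_def
        by (intro continuous_map_from_subtopology continuous_map_product_projection) auto
      from openin_continuous_map_preimage[OF this, of "{..<1 / (real N + 1)}"]
      show ?thesis by (simp add: V U_def)
    qed
    show "topspace X \<subseteq> \<Union> (U ` {..N})"
      by (auto simp: topX U_def)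
    show "singular_chain N X (c N)" by (simp add: cX)
  qed blast
  define sd :: "nat \<Rightarrow> (nat \<Rightarrow> real) chain \<Rightarrow> (nat \<Rightarrow> real) chain"
    where "sd p = iterated_subdivision m0 p" for p
  have final: "sperner_count l N (sd N (c N)) = 0"
  proof (rule sperner_count_eq_0)
    fix \<sigma> assume \<sigma>: "\<sigma> \<in> Poly_Mapping.keys (sd N (c N))"
    then obtain i where i: "i \<le> N" "\<sigma> \<in> standard_simplex N \<rightarrow> U i"
      using m0[OF order_refl] by (auto simp: sd_def)
    have "l (\<sigma> (corner j)) \<noteq> i" if "j \<le> N" for j
    proof -
      have "\<sigma> (corner j) \<in> U i" using i(2) that by auto
      then have "\<sigma> (corner j) \<in> standard_simplex N" "\<sigma> (corner j) i < 1 / (real N + 1)"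
        by (auto simp: U_def topX)
      then show ?thesis using l[of "\<sigma> (corner j)"] by auto
    qed
    then have "i \<notin> (\<lambda>j. l (\<sigma> (corner j))) ` {..N}" by auto
    then show "\<not> fully_labelled l N \<sigma>" using i(1) by (auto simp: fully_labelled_def)
  qed
  \<comment> \<open>Labels respect faces, since the coordinate at the label of a point is nonzero.\<close>
  have label_in: "l (\<sigma> x) \<in> S"
    if c': "singular_chain q (subtopology X {x. \<forall>i. i \<notin> S \<longrightarrow> x i = 0}) c'"
      and \<sigma>: "\<sigma> \<in> Poly_Mapping.keys c'" and x: "x \<in> standard_simplex q" for c' q S \<sigma> x
  proof -
    have "\<sigma> x \<in> topspace (subtopology X {x. \<forall>i. i \<notin> S \<longrightarrow> x i = 0})"
    proof -
      have "singular_simplex q (subtopology X {x. \<forall>i. i \<notin> S \<longrightarrow> x i = 0}) \<sigma>"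
        using c' \<sigma> by (auto simp: singular_chain_def)
      then show ?thesis
        using x continuous_map_image_subset_topspace by (fastforce simp: singular_simplex_def)
    qed
    then have "\<sigma> x \<in> standard_simplex N" "\<forall>i. i \<notin> S \<longrightarrow> \<sigma> x i = 0"
      by (auto simp: topX)
    then show ?thesis using l_supp by blast
  qed
  have g_supp: "singular_chain q (subtopology X {x. \<forall>i. i \<notin> B q \<longrightarrow> x i = 0}) (frag_of (g q B))"
    if "flag N q B" for q B
    using simplex[OF that] supp[OF that]
    by (auto simp: singular_chain_of singular_simplex_subtopology X_def)
  define \<Psi> where "\<Psi> q B = sperner_count l q (sd q (frag_of (g q B)))" for q B
  have count_c: "sperner_count l p (sd p (c p)) = (\<Sum>\<pi> | \<pi> permutes {..p}. \<Psi> p (perm_flag \<pi>))" for p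
    by (simp add: \<Psi>_def c_def sd_def iterated_subdivision_sum sperner_count_sum)
  have odd: "odd (sperner_count l p (sd p (c p)))" if "p \<le> N" for p
    using that
  proof (induction p)
    case 0
    have fl: "flag N 0 (perm_flag id)" using flag_perm_flag[of id 0 N 0] by (simp add: permutes_id)
    have "singular_chain 0 X (frag_of (g 0 (perm_flag id)))"
      using simplex[OF fl] by (simp add: singular_chain_of X_def)
    then have "sd 0 (frag_of (g 0 (perm_flag id))) = frag_of (g 0 (perm_flag id))"
      by (simp add: sd_def iterated_subdivision_0)
    moreover have "l (g 0 (perm_flag id) (corner 0)) \<in> perm_flag id 0"
      by (rule label_in[OF g_supp[OF fl], of "g 0 (perm_flag id)" "corner 0"]) simp_all
    then have "l (g 0 (perm_flag id) (corner 0)) = 0" by (simp add: perm_flag_def)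
    ultimately have "\<Psi> 0 (perm_flag id) = 1"
      by (simp add: \<Psi>_def fully_labelled_def)
    moreover have "{\<pi>. \<pi> permutes {..0::nat}} = {id}" by (auto simp: permutes_id)
    ultimately show ?case by (simp add: count_c)
  next
    case (Suc p)
    let ?P = "{\<pi>. \<pi> permutes {..Suc p}}"
    let ?Y = "subtopology X {x. \<forall>i. i \<notin> {..Suc p} \<longrightarrow> x i = 0}"
    have cY: "singular_chain (Suc p) ?Y (c (Suc p))"
      unfolding c_def
    proof (intro singular_chain_sum)
      fix \<pi> assume "\<pi> \<in> ?P"
      then have \<pi>: "\<pi> permutes {..Suc p}" by simp
      then show "singular_chain (Suc p) ?Y (frag_of (g (Suc p) (perm_flag \<pi>)))"
        using g_supp[OF flag_perm_flag[OF \<pi> Suc.prems order_refl]] permutes_image[OF \<pi>]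
        by (simp add: perm_flag_def)
    qed
    have "even (sperner_count l p (chain_boundary (Suc p) (sd (Suc p) (c (Suc p)))) -
         sperner_count l (Suc p) (sd (Suc p) (c (Suc p))))"
    proof (rule sperner_count_boundary)
      show "singular_chain (Suc p) ?Y (sd (Suc p) (c (Suc p)))"
        unfolding sd_def by (intro singular_chain_iterated_subdivision cY)
      show "l x \<le> Suc p" if "x \<in> topspace ?Y" for x
        using that l_supp[of x] by (auto simp: topX)
    qed
    moreover have "chain_boundary (Suc p) (sd (Suc p) (c (Suc p))) = sd p (chain_boundary (Suc p) (c (Suc p)))"
      using chain_boundary_iterated_subdivision[OF cY] by (simp add: sd_def)
    moreover have "sperner_count l p (sd p (chain_boundary (Suc p) (c (Suc p)))) =
      (\<Sum>\<pi>\<in>?P. \<Sum>k\<le>Suc p. (-1) ^ k * \<Psi> p (perm_flag \<pi> \<circ> skip k))"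
    proof -
      have cmul: "iterated_subdivision m0 p (frag_cmul ((-1)^k) a) = frag_cmul ((-1)^k) (iterated_subdivision m0 p a)"
        for k :: nat and a :: "(nat \<Rightarrow> real) chain"
        by (cases "even k") (simp_all add: iterated_subdivision_minus)
      have "chain_boundary (Suc p) (c (Suc p)) =
         (\<Sum>\<pi>\<in>?P. \<Sum>k\<le>Suc p. frag_cmul ((-1) ^ k) (frag_of (g p (perm_flag \<pi> \<circ> skip k))))"
        unfolding c_def chain_boundary_sum comp_def
      proof (rule sum.cong[OF refl])
        fix \<pi> assume "\<pi> \<in> ?P"
        then have fl: "flag N (Suc p) (perm_flag \<pi>)"
          using flag_perm_flag[OF _ Suc.prems order_refl] by simp
        show "chain_boundary (Suc p) (frag_of (g (Suc p) (perm_flag \<pi>))) =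
          (\<Sum>k\<le>Suc p. frag_cmul ((-1) ^ k) (frag_of (g p (\<lambda>j. perm_flag \<pi> (skip k j)))))"
          unfolding chain_boundary_of using face[OF fl]
          by (simp add: comp_def del: sum.atMost_Suc)
      qed
      then show ?thesis
        by (simp add: sd_def iterated_subdivision_sum cmul sperner_count_sum \<Psi>_def del: sum.atMost_Suc)
    qed
    moreover have "\<dots> = (\<Sum>k\<le>Suc p. (-1) ^ k * (\<Sum>\<pi>\<in>?P. \<Psi> p (perm_flag \<pi> \<circ> skip k)))"
      by (subst sum.swap) (simp add: sum_distrib_left)
    moreover have "\<dots> = (\<Sum>k\<le>p. (-1) ^ k * (\<Sum>\<pi>\<in>?P. \<Psi> p (perm_flag \<pi> \<circ> skip k)))
        + (-1) ^ Suc p * (\<Sum>\<pi>\<in>?P. \<Psi> p (perm_flag \<pi> \<circ> skip (Suc p)))"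
      by simp
    \<comment> \<open>Facets interior to the subdivision: exchanging \<open>\<pi> k\<close> and \<open>\<pi> (Suc k)\<close> alters only the
      \<open>k\<close>-th set of the flag, the one that the facet omits.\<close>
    moreover have "even (\<Sum>k\<le>p. (-1) ^ k * (\<Sum>\<pi>\<in>?P. \<Psi> p (perm_flag \<pi> \<circ> skip k)))"
    proof (rule dvd_sum, rule dvd_mult)
      fix k assume "k \<in> {..p}"
      then have k: "k \<le> p" by simp
      show "even (\<Sum>\<pi>\<in>?P. \<Psi> p (perm_flag \<pi> \<circ> skip k))"
      proof (rule even_sum_permutations[of k _ "Suc k"])
        fix \<pi> assume "\<pi> permutes {..Suc p}"
        have "perm_flag (\<pi> \<circ> Transposition.transpose k (Suc k)) (skip k i) = perm_flag \<pi> (skip k i)" for i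
        proof -
          have "Transposition.transpose k (Suc k) ` {..skip k i} = {..skip k i}"
            unfolding transpose_image_eq by (auto simp: skip_def)
          then show ?thesis by (simp only: perm_flag_def image_comp[symmetric])
        qed
        then have "perm_flag (\<pi> \<circ> Transposition.transpose k (Suc k)) \<circ> skip k = perm_flag \<pi> \<circ> skip k"
          by (simp add: fun_eq_iff)
        then show "\<Psi> p (perm_flag (\<pi> \<circ> Transposition.transpose k (Suc k)) \<circ> skip k) = \<Psi> p (perm_flag \<pi> \<circ> skip k)"
          by simp
      qed (use k in auto)
    qed
    \<comment> \<open>Outer facets: the one of \<open>\<pi>\<close> lies in the face opposite the vertex \<open>\<pi> (Suc p)\<close>.\<close>
    moreover have "(\<Sum>\<pi>\<in>?P. \<Psi> p (perm_flag \<pi> \<circ> skip (Suc p))) = sperner_count l p (sd p (c p))"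
    proof -
      have "(\<Sum>\<pi>\<in>?P. \<Psi> p (perm_flag \<pi> \<circ> skip (Suc p))) = (\<Sum>\<pi> | \<pi> permutes {..p}. \<Psi> p (perm_flag \<pi> \<circ> skip (Suc p)))"
      proof (rule sum.mono_neutral_right)
        show "{\<pi>. \<pi> permutes {..p}} \<subseteq> ?P"
          by (auto intro: permutes_subset)
        show "\<forall>\<pi> \<in> ?P - {\<pi>. \<pi> permutes {..p}}. \<Psi> p (perm_flag \<pi> \<circ> skip (Suc p)) = 0"
        proof
          fix \<pi> assume "\<pi> \<in> ?P - {\<pi>. \<pi> permutes {..p}}"
          then have \<pi>: "\<pi> permutes {..Suc p}" and n: "\<not> \<pi> permutes {..p}" by auto
          have "\<pi> (Suc p) \<noteq> Suc p"
          proof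
            assume e: "\<pi> (Suc p) = Suc p"
            have "\<pi> permutes {..p}"
              by (rule permutes_superset[OF \<pi>]) (use e in \<open>auto simp: le_Suc_eq\<close>)
            then show False using n by simp
          qed
          then have v: "\<pi> (Suc p) \<le> p" using permutes_in_image[OF \<pi>, of "Suc p"] by simp
          let ?B = "perm_flag \<pi> \<circ> skip (Suc p)"
          have B: "flag N p ?B" by (rule flag_skip) (rule flag_perm_flag[OF \<pi> Suc.prems order_refl])
          have vB: "\<pi> (Suc p) \<notin> ?B p"
            by (simp add: perm_flag_def skip_def inj_image_mem_iff[OF permutes_inj[OF \<pi>]])
          show "\<Psi> p ?B = 0"
            unfolding \<Psi>_def
          proof (rule sperner_count_eq_0)
            fix \<sigma> assume \<sigma>: "\<sigma> \<in> Poly_Mapping.keys (sd p (frag_of (g p ?B)))"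
            have "l (\<sigma> (corner j)) \<in> ?B p" if "j \<le> p" for j
              by (rule label_in[OF singular_chain_iterated_subdivision[OF g_supp[OF B]]
                    \<sigma>[unfolded sd_def]]) (use that in simp)
            then have "\<pi> (Suc p) \<notin> (\<lambda>j. l (\<sigma> (corner j))) ` {..p}" using vB by auto
            then show "\<not> fully_labelled l p \<sigma>" using v by (auto simp: fully_labelled_def)
          qed
        qed
      qed (rule fin)
      also have "\<dots> = (\<Sum>\<pi> | \<pi> permutes {..p}. \<Psi> p (perm_flag \<pi>))"
      proof (rule sum.cong[OF refl])
        fix \<pi>
        have "g p (perm_flag \<pi> \<circ> skip (Suc p)) = g p (perm_flag \<pi>)"
          by (rule cong) (simp add: skip_def)
        then show "\<Psi> p (perm_flag \<pi> \<circ> skip (Suc p)) = \<Psi> p (perm_flag \<pi>)"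
          by (simp add: \<Psi>_def)
      qed
      finally show ?thesis by (simp add: count_c)
    qed
    moreover have "odd (sperner_count l p (sd p (c p)))" using Suc by simp
    ultimately show ?case by (simp add: even_diff_iff)
  qed
  show False using odd[of N] final by simp
qed

section \<open>The Tot tower is a tower\<close>

lemma Delta_hom_id [simp]: "(\<lambda>i\<in>{..n}. i) \<in> Delta_hom n n"
  by (auto simp: Delta_hom_def mono_on_def)

lemma Delta_hom_le: "\<theta> \<in> Delta_hom m n \<Longrightarrow> i \<le> m \<Longrightarrow> \<theta> i \<le> n"
  by (auto simp: Delta_hom_def)

lemma Delta_hom_mono: "\<theta> \<in> Delta_hom m n \<Longrightarrow> i \<le> j \<Longrightarrow> j \<le> m \<Longrightarrow> \<theta> i \<le> \<theta> j"
  by (auto simp: Delta_hom_def mono_on_def)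

lemma Delta_hom_extensional: "\<theta> \<in> Delta_hom m n \<Longrightarrow> \<theta> \<in> extensional {..m}"
  by (auto simp: Delta_hom_def PiE_def)

lemma Delta_homI:
  assumes "\<And>i. i \<le> m \<Longrightarrow> \<theta> i \<le> n" "\<And>i j. i \<le> j \<Longrightarrow> j \<le> m \<Longrightarrow> \<theta> i \<le> \<theta> j" "\<theta> \<in> extensional {..m}"
  shows "\<theta> \<in> Delta_hom m n"
  using assms by (auto simp: Delta_hom_def mono_on_def PiE_def)

lemma Delta_hom_compose:
  assumes "\<theta> \<in> Delta_hom l m" "\<phi> \<in> Delta_hom m n"
  shows "compose {..l} \<phi> \<theta> \<in> Delta_hom l n"
proof (rule Delta_homI)
  show "compose {..l} \<phi> \<theta> i \<le> n" if "i \<le> l" for i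
    using that assms by (simp add: compose_eq Delta_hom_le)
  show "compose {..l} \<phi> \<theta> i \<le> compose {..l} \<phi> \<theta> j" if "i \<le> j" "j \<le> l" for i j
  proof -
    have "\<theta> i \<le> \<theta> j" "\<theta> j \<le> m" using that assms Delta_hom_mono Delta_hom_le by blast+
    then show ?thesis using that assms(2) by (simp add: compose_eq Delta_hom_mono)
  qed
qed (simp add: compose_extensional)

lemma Delta_hom_assoc:
  "\<theta> \<in> Delta_hom l m \<Longrightarrow> compose {..l} \<psi> (compose {..l} \<phi> \<theta>) = compose {..l} (compose {..m} \<psi> \<phi>) \<theta>"
  by (auto simp: compose_def Delta_hom_le intro!: restrict_ext)

lemma Delta_hom_compose_id: "\<theta> \<in> Delta_hom m n \<Longrightarrow> compose {..m} (\<lambda>i\<in>{..n}. i) \<theta> = \<theta>"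
  by (rule extensionalityI[of _ "{..m}"]) (auto simp: compose_eq Delta_hom_le Delta_hom_extensional compose_extensional)

abbreviation over_nerve :: "nat \<Rightarrow> nat \<Rightarrow> (nat, nat \<Rightarrow> nat) over_simplex sset" where
  "over_nerve r c \<equiv> nerve (over_cat (Delta_trunc r) c)"

lemma over_nerve_iff:
  "(A, H) \<in> simplices (over_nerve r c) k \<longleftrightarrow>
    A \<in> extensional {..k} \<and> (\<forall>i\<le>k. fst (A i) \<le> r \<and> snd (A i) \<in> Delta_hom (fst (A i)) c) \<and>
    H \<in> extensional {(i, j). i \<le> j \<and> j \<le> k} \<and>
    (\<forall>i j. i \<le> j \<and> j \<le> k \<longrightarrow> H (i, j) \<in> Delta_hom (fst (A i)) (fst (A j)) \<and>
       compose {..fst (A i)} (snd (A j)) (H (i, j)) = snd (A i)) \<and>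
    (\<forall>i\<le>k. H (i, i) = (\<lambda>x\<in>{..fst (A i)}. x)) \<and>
    (\<forall>i j l. i \<le> j \<and> j \<le> l \<and> l \<le> k \<longrightarrow> H (i, l) = compose {..fst (A i)} (H (j, l)) (H (i, j)))"
proof -
  have 1: "A \<in> {..k} \<rightarrow>\<^sub>E Obj (over_cat (Delta_trunc r) c) \<longleftrightarrow>
     A \<in> extensional {..k} \<and> (\<forall>i\<le>k. fst (A i) \<le> r \<and> snd (A i) \<in> Delta_hom (fst (A i)) c)"
    by (auto simp: over_cat_def Delta_trunc_def PiE_def Pi_iff case_prod_beta)
  have 2: "H \<in> (\<Pi>\<^sub>E (i, j)\<in>{(i, j). i \<le> j \<and> j \<le> k}. Hom (over_cat (Delta_trunc r) c) (A i) (A j)) \<longleftrightarrow>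
     H \<in> extensional {(i, j). i \<le> j \<and> j \<le> k} \<and>
    (\<forall>i j. i \<le> j \<and> j \<le> k \<longrightarrow> H (i, j) \<in> Delta_hom (fst (A i)) (fst (A j)) \<and>
       compose {..fst (A i)} (snd (A j)) (H (i, j)) = snd (A i))"
    by (auto simp: over_cat_def Delta_trunc_def PiE_def Pi_iff case_prod_beta)
  have 3: "Ident (over_cat (Delta_trunc r) c) x = (\<lambda>i\<in>{..fst x}. i)"
    and 4: "Comp (over_cat (Delta_trunc r) c) x y z f g = compose {..fst x} f g" for x y z f g
    by (auto simp: over_cat_def Delta_trunc_def case_prod_beta)
  show ?thesis
    by (simp only: nerve_def sset.simps mem_Collect_eq case_prod_conv 1 2 3 4 conj_assoc)
qed

lemma nerve_act_closed:
  assumes "\<sigma> \<in> simplices (over_nerve r c) n" "\<theta> \<in> Delta_hom m n"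
  shows "act (over_nerve r c) m n \<theta> \<sigma> \<in> simplices (over_nerve r c) m"
proof -
  obtain A H where \<sigma>: "\<sigma> = (A, H)" by fastforce
  have \<theta>: "i \<le> j \<Longrightarrow> j \<le> m \<Longrightarrow> \<theta> i \<le> \<theta> j" "j \<le> m \<Longrightarrow> \<theta> j \<le> n" for i j
    using assms(2) Delta_hom_mono Delta_hom_le by blast+
  have "act (over_nerve r c) m n \<theta> (A, H) =
     (\<lambda>i\<in>{..m}. A (\<theta> i), \<lambda>(i, j)\<in>{(i, j). i \<le> j \<and> j \<le> m}. H (\<theta> i, \<theta> j))"
    by (simp add: nerve_def)
  then show ?thesis
    using assms(1) \<theta> unfolding \<sigma> by (simp add: over_nerve_iff)
qed

lemma over_nerve_map_closed:
  assumes "\<sigma> \<in> simplices (over_nerve r c) k" "u \<in> Delta_hom c d"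
  shows "over_nerve_map (Delta_trunc r) c d u k \<sigma> \<in> simplices (over_nerve r d) k"
proof -
  obtain A H where \<sigma>: "\<sigma> = (A, H)" by fastforce
  have "over_nerve_map (Delta_trunc r) c d u k (A, H) =
     (\<lambda>i\<in>{..k}. (fst (A i), compose {..fst (A i)} u (snd (A i))), H)"
    by (simp add: over_nerve_map_def Delta_trunc_def)
  moreover have "compose {..fst (A i)} (compose {..fst (A j)} u (snd (A j))) (H (i, j)) = compose {..fst (A i)} u (snd (A i))"
    if "i \<le> j" "j \<le> k" for i j
  proof -
    have "H (i, j) \<in> Delta_hom (fst (A i)) (fst (A j))"
      "compose {..fst (A i)} (snd (A j)) (H (i, j)) = snd (A i)"
      using that assms(1) unfolding \<sigma> by (simp_all add: over_nerve_iff)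
    then show ?thesis by (metis Delta_hom_assoc)
  qed
  moreover have "compose {..fst (A i)} u (snd (A i)) \<in> Delta_hom (fst (A i)) d" if "i \<le> k" for i
    using that assms unfolding \<sigma> by (intro Delta_hom_compose) (auto simp: over_nerve_iff)
  ultimately show ?thesis
    using assms(1) unfolding \<sigma> by (simp add: over_nerve_iff)
qed

lemma over_nerve_mono: "r \<le> s \<Longrightarrow> simplices (over_nerve r c) k \<subseteq> simplices (over_nerve s c) k"
  by (force simp: over_nerve_iff)

lemma over_nerve_map_trunc:
  "over_nerve_map (Delta_trunc r) c d u k = over_nerve_map (Delta_trunc s) c d u k"
  by (simp add: over_nerve_map_def Delta_trunc_def)

lemma Delta_trunc_simps [simp]:
  "Obj (Delta_trunc r) = {..r}" "Hom (Delta_trunc r) = Delta_hom"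
  by (simp_all add: Delta_trunc_def)

lemma act_over_nerve_trunc: "act (over_nerve r c) = act (over_nerve s c)"
  by (simp add: nerve_def)

lemma std_simplex_simps [simp]:
  "simplices (std_simplex p) k = Delta_hom k p" "act (std_simplex p) m n \<theta> x = compose {..m} x \<theta>"
  by (simp_all add: std_simplex_def)

lemma prod_sset_simps [simp]:
  "simplices (prod_sset X Y) n = simplices X n \<times> simplices Y n"
  "act (prod_sset X Y) m n \<theta> = map_prod (act X m n \<theta>) (act Y m n \<theta>)"
  by (simp_all add: prod_sset_def)

text \<open>The \<open>k\<close>-simplices of the Bousfield-Kan homotopy limit over the truncated simplex category, as a
  list of conditions on the values of \<open>F\<close>: extensionality, being simplicial, and naturality in the
  object.\<close>

definition natural_family ::
  "nat \<Rightarrow> (nat, nat \<Rightarrow> nat, 'a) diagram \<Rightarrow> nat \<Rightarrow> (nat, nat \<Rightarrow> nat, 'a) nat_family \<Rightarrow> bool" where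
  "natural_family r X k F \<longleftrightarrow>
    F \<in> extensional {..r} \<and>
    (\<forall>c\<le>r. \<forall>n. F c n \<in> extensional (simplices (over_nerve r c) n \<times> Delta_hom n k)) \<and>
    (\<forall>c\<le>r. \<forall>n. \<forall>\<sigma>\<in>simplices (over_nerve r c) n. \<forall>\<tau>\<in>Delta_hom n k.
        F c n (\<sigma>, \<tau>) \<in> simplices (ob X c) n \<and>
        (\<forall>m. \<forall>\<theta>\<in>Delta_hom m n. F c m (act (over_nerve r c) m n \<theta> \<sigma>, compose {..m} \<tau> \<theta>) =
           act (ob X c) m n \<theta> (F c n (\<sigma>, \<tau>))) \<and>
        (\<forall>d\<le>r. \<forall>u\<in>Delta_hom c d. F d n (over_nerve_map (Delta_trunc r) c d u n \<sigma>, \<tau>) =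
           mor X c d u n (F c n (\<sigma>, \<tau>))))"

lemma bk_holim_iff: "F \<in> simplices (bk_holim (Delta_trunc r) X) k \<longleftrightarrow> natural_family r X k F"
  unfolding bk_holim_def natural_family_def sset_hom_def
  by (simp add: PiE_iff) blast

lemma bk_holim_act:
  "act (bk_holim (Delta_trunc r) X) k l \<theta> F =
    (\<lambda>c\<in>{..r}. \<lambda>n. \<lambda>(\<sigma>, \<tau>)\<in>simplices (over_nerve r c) n \<times> Delta_hom n k. F c n (\<sigma>, compose {..n} \<theta> \<tau>))"
  by (simp add: bk_holim_def)

lemma natural_familyD:
  assumes "natural_family r X k F" "c \<le> r" "\<sigma> \<in> simplices (over_nerve r c) n" "\<tau> \<in> Delta_hom n k"
  shows "F c n (\<sigma>, \<tau>) \<in> simplices (ob X c) n"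
    and "\<theta> \<in> Delta_hom m n \<Longrightarrow> F c m (act (over_nerve r c) m n \<theta> \<sigma>, compose {..m} \<tau> \<theta>) =
           act (ob X c) m n \<theta> (F c n (\<sigma>, \<tau>))"
    and "d \<le> r \<Longrightarrow> u \<in> Delta_hom c d \<Longrightarrow> F d n (over_nerve_map (Delta_trunc r) c d u n \<sigma>, \<tau>) =
           mor X c d u n (F c n (\<sigma>, \<tau>))"
  using assms by (simp_all add: natural_family_def)

lemma natural_family_eqI:
  assumes F: "natural_family r X k F" and G: "natural_family r X k G"
    and eq: "\<And>c n \<sigma> \<tau>. c \<le> r \<Longrightarrow> \<sigma> \<in> simplices (over_nerve r c) n \<Longrightarrow> \<tau> \<in> Delta_hom n k \<Longrightarrow>
      F c n (\<sigma>, \<tau>) = G c n (\<sigma>, \<tau>)"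
  shows "F = G"
proof (rule extensionalityI[of _ "{..r}"])
  fix c assume c: "c \<in> {..r}"
  show "F c = G c"
  proof
    fix n
    show "F c n = G c n"
      by (rule extensionalityI[of _ "simplices (over_nerve r c) n \<times> Delta_hom n k"])
        (use F G eq c in \<open>auto simp: natural_family_def\<close>)
  qed
qed (use F G in \<open>auto simp: natural_family_def\<close>)

lemma natural_family_act:
  assumes F: "natural_family r X l F" and \<theta>: "\<theta> \<in> Delta_hom k l"
  shows "natural_family r X k (act (bk_holim (Delta_trunc r) X) k l \<theta> F)"
  unfolding natural_family_def bk_holim_act
  using natural_familyD[OF F] \<theta>
  by (auto simp: nerve_act_closed over_nerve_map_closed Delta_hom_compose Delta_hom_assoc)

lemma is_sset_bk_holim: "is_sset (bk_holim (Delta_trunc r) X)"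
  unfolding is_sset_def
proof (intro conjI allI ballI funcsetI)
  let ?L = "bk_holim (Delta_trunc r) X"
  show "act ?L m n \<theta> F \<in> simplices ?L m" if "\<theta> \<in> Delta_hom m n" "F \<in> simplices ?L n" for m n \<theta> F
    using that by (simp add: bk_holim_iff natural_family_act)
  show "act ?L n n (\<lambda>i\<in>{..n}. i) F = F" if "F \<in> simplices ?L n" for n F
  proof (rule natural_family_eqI)
    show "natural_family r X n F" using that by (simp add: bk_holim_iff)
    then show "natural_family r X n (act ?L n n (\<lambda>i\<in>{..n}. i) F)"
      by (simp add: natural_family_act)
  qed (simp add: bk_holim_act Delta_hom_compose_id)
  show "act ?L l m \<phi> (act ?L m n \<theta> F) = act ?L l n (compose {..l} \<theta> \<phi>) F"
    if h: "\<phi> \<in> Delta_hom l m" "\<theta> \<in> Delta_hom m n" and F: "F \<in> simplices ?L n" for l m n \<phi> \<theta> F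
  proof (rule natural_family_eqI)
    show "natural_family r X l (act ?L l m \<phi> (act ?L m n \<theta> F))"
      and "natural_family r X l (act ?L l n (compose {..l} \<theta> \<phi>) F)"
      using h F by (simp_all add: bk_holim_iff natural_family_act Delta_hom_compose)
  qed (use h in \<open>simp add: bk_holim_act Delta_hom_compose Delta_hom_assoc\<close>)
qed

lemma holim_restrict_apply:
  assumes "F \<in> simplices (Tot s X) k"
  shows "holim_restrict (Delta_trunc r) (Delta_trunc s) X k F =
    (\<lambda>c\<in>{..r}. \<lambda>n. restrict (F c n) (simplices (over_nerve r c) n \<times> Delta_hom n k))"
  using assms by (simp add: holim_restrict_def Tot_def)

lemma Tot_iff: "F \<in> simplices (Tot r X) k \<longleftrightarrow> natural_family r (fib_diagram X) k F"
  by (simp add: Tot_def holim_def bk_holim_iff)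

text \<open>Truncation only removes simplices from the nerves and objects from the diagram, so all the
  identities survive the restriction.\<close>

lemma natural_family_restrict:
  assumes "natural_family s X k F" "r \<le> s"
  shows "natural_family r X k (\<lambda>c\<in>{..r}. \<lambda>n. restrict (F c n) (simplices (over_nerve r c) n \<times> Delta_hom n k))"
proof -
  have sub: "\<sigma> \<in> simplices (over_nerve s c) n" if "\<sigma> \<in> simplices (over_nerve r c) n" for c n \<sigma>
    using that over_nerve_mono[OF assms(2)] by blast
  have D: "F c n (\<sigma>, \<tau>) \<in> simplices (ob X c) n"
     "\<theta> \<in> Delta_hom m n \<Longrightarrow> F c m (act (over_nerve r c) m n \<theta> \<sigma>, compose {..m} \<tau> \<theta>) =
           act (ob X c) m n \<theta> (F c n (\<sigma>, \<tau>))"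
     "d \<le> r \<Longrightarrow> u \<in> Delta_hom c d \<Longrightarrow> F d n (over_nerve_map (Delta_trunc r) c d u n \<sigma>, \<tau>) =
           mor X c d u n (F c n (\<sigma>, \<tau>))"
    if "c \<le> r" "\<sigma> \<in> simplices (over_nerve r c) n" "\<tau> \<in> Delta_hom n k" for c n \<sigma> \<tau> m \<theta> d u
    using natural_familyD[OF assms(1) _ sub[OF that(2)] that(3)] that(1) assms(2)
    by (simp_all add: over_nerve_map_trunc[of r _ _ _ _ s] act_over_nerve_trunc[of r _ s])
  show ?thesis
    unfolding natural_family_def
    using D by (auto simp: nerve_act_closed over_nerve_map_closed Delta_hom_compose)
qed

lemma is_tower_Tot_tower: "is_tower (Tot_tower X)"
proof -
  let ?R = "\<lambda>r s. holim_restrict (Delta_trunc r) (Delta_trunc s) X"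
  have mem: "?R r s k F \<in> simplices (Tot r X) k" if "r \<le> s" "F \<in> simplices (Tot s X) k" for r s k F
    using that by (simp add: holim_restrict_apply Tot_iff natural_family_restrict)
  have ap: "?R r s k F c n (\<sigma>, \<tau>) = F c n (\<sigma>, \<tau>)"
    if "F \<in> simplices (Tot s X) k" "c \<le> r" "\<sigma> \<in> simplices (over_nerve r c) n" "\<tau> \<in> Delta_hom n k"
    for r s k F c n \<sigma> \<tau>
    using that by (simp add: holim_restrict_apply)
  have eqI: "F = G" if "F \<in> simplices (Tot r X) k" "G \<in> simplices (Tot r X) k"
     "\<And>c n \<sigma> \<tau>. c \<le> r \<Longrightarrow> \<sigma> \<in> simplices (over_nerve r c) n \<Longrightarrow> \<tau> \<in> Delta_hom n k \<Longrightarrow>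
      F c n (\<sigma>, \<tau>) = G c n (\<sigma>, \<tau>)" for r k F G
    using that natural_family_eqI unfolding Tot_iff by blast
  have sset: "is_sset (Tot s X)" for s
    by (simp add: Tot_def holim_def is_sset_bk_holim)
  have sub: "\<sigma> \<in> simplices (over_nerve s c) n" if "\<sigma> \<in> simplices (over_nerve r c) n" "r \<le> s" for r s c n \<sigma>
    using that over_nerve_mono by blast
  have act_mem: "act (Tot s X) m n \<theta> F \<in> simplices (Tot s X) m"
    if "\<theta> \<in> Delta_hom m n" "F \<in> simplices (Tot s X) n" for s m n \<theta> F
    using sset that unfolding is_sset_def by blast
  have act: "act (Tot s X) k l \<theta> F = 
    (\<lambda>c\<in>{..s}. \<lambda>n. \<lambda>(\<sigma>, \<tau>)\<in>simplices (over_nerve s c) n \<times> Delta_hom n k. F c n (\<sigma>, compose {..n} \<theta> \<tau>))" for s k l \<theta> F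
    by (simp add: Tot_def holim_def bk_holim_act)
  have hom: "?R r s \<in> sset_hom (Tot s X) (Tot r X)" if rs: "r \<le> s" for r s
    unfolding sset_hom_def mem_Collect_eq
  proof (intro conjI allI ballI PiE_I)
    show "?R r s m (act (Tot s X) m n \<theta> F) = act (Tot r X) m n \<theta> (?R r s n F)"
      if h: "\<theta> \<in> Delta_hom m n" "F \<in> simplices (Tot s X) n" for m n \<theta> F
    proof (rule eqI)
      show "?R r s m (act (Tot s X) m n \<theta> F) \<in> simplices (Tot r X) m"
        "act (Tot r X) m n \<theta> (?R r s n F) \<in> simplices (Tot r X) m"
        using h rs mem act_mem by blast+
      fix c p \<sigma> \<tau> assume a: "c \<le> r" "\<sigma> \<in> simplices (over_nerve r c) p" "\<tau> \<in> Delta_hom p m"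
      have "?R r s m (act (Tot s X) m n \<theta> F) c p (\<sigma>, \<tau>) = act (Tot s X) m n \<theta> F c p (\<sigma>, \<tau>)"
        using h a act_mem ap by blast
      also have "\<dots> = F c p (\<sigma>, compose {..p} \<theta> \<tau>)"
        using a rs sub[OF a(2) rs] by (simp add: act)
      also have "\<dots> = act (Tot r X) m n \<theta> (?R r s n F) c p (\<sigma>, \<tau>)"
        using a h ap[OF h(2) a(1,2), of "compose {..p} \<theta> \<tau>"] by (simp add: act Delta_hom_compose)
      finally show "?R r s m (act (Tot s X) m n \<theta> F) c p (\<sigma>, \<tau>) = act (Tot r X) m n \<theta> (?R r s n F) c p (\<sigma>, \<tau>)" .
    qed
  next
    show "?R r s n F \<in> simplices (Tot r X) n" if "F \<in> simplices (Tot s X) n" for n F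
      using that rs by (rule mem[rotated])
    show "?R r s n F = undefined" if "F \<notin> simplices (Tot s X) n" for n F
      using that by (simp add: holim_restrict_def Tot_def)
  qed
  show ?thesis
    unfolding is_tower_def Tot_tower_def
  proof (simp add: sset hom, intro conjI allI impI ballI)
    show "?R s s n F = F" if "F \<in> simplices (Tot s X) n" for s n F
      by (rule eqI) (use that mem ap in auto)
    show "?R r s n (?R s t n F) = ?R r t n F"
      if "r \<le> s" "s \<le> t" "F \<in> simplices (Tot t X) n" for r s t n F
    proof (rule eqI)
      show "?R r s n (?R s t n F) \<in> simplices (Tot r X) n" "?R r t n F \<in> simplices (Tot r X) n"
        using that mem by (meson order_trans)+
      fix c p \<sigma> \<tau> assume a: "c \<le> r" "\<sigma> \<in> simplices (over_nerve r c) p" "\<tau> \<in> Delta_hom p n"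
      have "?R r s n (?R s t n F) c p (\<sigma>, \<tau>) = ?R s t n F c p (\<sigma>, \<tau>)"
        by (rule ap) (use a that mem in auto)
      also have "\<dots> = F c p (\<sigma>, \<tau>)"
        by (rule ap) (use a that sub in auto)
      also have "\<dots> = ?R r t n F c p (\<sigma>, \<tau>)"
        by (rule ap[symmetric]) (use a that in auto)
      finally show "?R r s n (?R s t n F) c p (\<sigma>, \<tau>) = ?R r t n F c p (\<sigma>, \<tau>)" .
    qed
  qed
qed

section \<open>Barycentric coordinates on the realization of a skeleton\<close>

lemma simplex_push_compose:
  assumes "\<theta> \<in> Delta_hom m n"
  shows "simplex_push n x (simplex_push m \<theta> t) = simplex_push m (compose {..m} x \<theta>) t"
proof
  fix i
  have "simplex_push n x (simplex_push m \<theta> t) i =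
      (\<Sum>j\<in>{j. j \<le> n \<and> x j = i}. \<Sum>l\<in>{l. l \<le> m \<and> \<theta> l = j}. t l)"
    by (simp add: simplex_push_def)
  also have "\<dots> = sum t (\<Union>j\<in>{j. j \<le> n \<and> x j = i}. {l. l \<le> m \<and> \<theta> l = j})"
    by (rule sum.UNION_disjoint[symmetric]) auto
  also have "(\<Union>j\<in>{j. j \<le> n \<and> x j = i}. {l. l \<le> m \<and> \<theta> l = j}) = {l. l \<le> m \<and> compose {..m} x \<theta> l = i}"
    using Delta_hom_le[OF assms] by (auto simp: compose_eq)
  finally show "simplex_push n x (simplex_push m \<theta> t) i = simplex_push m (compose {..m} x \<theta>) t i"
    by (simp add: simplex_push_def)
qed

lemma simplex_push_outside:
  "(\<And>j. j \<le> m \<Longrightarrow> \<theta> j \<noteq> i) \<Longrightarrow> simplex_push m \<theta> t i = 0"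
  unfolding simplex_push_def by (rule sum.neutral) auto

lemma simplex_push_in_standard_simplex:
  assumes t: "t \<in> standard_simplex m" and \<theta>: "\<And>j. j \<le> m \<Longrightarrow> \<theta> j \<le> n"
  shows "simplex_push m \<theta> t \<in> standard_simplex n"
proof -
  have t01: "0 \<le> t j" and t1: "sum t {..m} = 1" for j using t by (auto simp: standard_simplex_def)
  have nn: "0 \<le> simplex_push m \<theta> t i" for i
    by (simp add: simplex_push_def sum_nonneg t01)
  have le: "simplex_push m \<theta> t i \<le> 1" for i
    unfolding simplex_push_def t1[symmetric] by (rule sum_mono2) (auto simp: t01)
  have "sum (simplex_push m \<theta> t) {..n} = (\<Sum>i\<le>n. sum t {j \<in> {..m}. \<theta> j = i})"
    by (simp add: simplex_push_def)
  also have "\<dots> = sum t {..m}"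
    by (rule sum.group) (use \<theta> in auto)
  finally have "sum (simplex_push m \<theta> t) {..n} = 1" by (simp add: t1)
  moreover have "simplex_push m \<theta> t i = 0" if "n < i" for i
    by (rule simplex_push_outside) (use that \<theta> in fastforce)
  ultimately show ?thesis using nn le by (simp add: standard_simplex_def)
qed

lemma continuous_map_simplex_push:
  "continuous_map (subtopology (powertop_real UNIV) S) (powertop_real UNIV) (simplex_push m \<theta>)"
  unfolding continuous_map_componentwise_UNIV simplex_push_def
  by (intro allI continuous_map_sum continuous_map_from_subtopology continuous_map_product_projection) auto

lemma simplex_push_coface:
  assumes "t \<in> standard_simplex q" "k \<le> Suc q"
  shows "simplex_push q (coface q k) t = simplical_face k t"
proof
  fix i
  have t0: "t j = 0" if "q < j" for j using assms(1) that by (simp add: standard_simplex_def)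
  have iff: "j \<le> q \<and> coface q k j = i \<longleftrightarrow> j \<le> q \<and> (if i < k then j = i else i \<noteq> k \<and> j = i - 1)" for j
    by (cases "j \<le> q"; cases "j < k") (auto simp: coface_def)
  consider "i < k" | "i = k" | "k < i" by linarith
  then show "simplex_push q (coface q k) t i = simplical_face k t i"
  proof cases
    case 1
    then have "{j. j \<le> q \<and> coface q k j = i} = (if i \<le> q then {i} else {})"
      by (auto simp: iff)
    then show ?thesis using 1 t0[of i] by (simp add: simplex_push_def simplical_face_def)
  next
    case 2
    have "simplex_push q (coface q k) t i = 0"
      by (rule simplex_push_outside) (use 2 in \<open>simp add: coface_def\<close>)
    then show ?thesis using 2 by (simp add: simplical_face_def)
  next
    case 3
    then have "{j. j \<le> q \<and> coface q k j = i} = (if i - 1 \<le> q then {i - 1} else {})"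
      by (auto simp: iff)
    then show ?thesis using 3 t0[of "i - 1"] by (simp add: simplex_push_def simplical_face_def)
  qed
qed

lemma coface_Delta_hom: "coface q k \<in> Delta_hom q (Suc q)"
  by (auto simp: Delta_hom_def coface_def mono_on_def)

text \<open>The two conditions on \<open>U\<close> are stable under finite intersections and unions, because taking
  preimages under \<open>t \<mapsto> [n, x, t]\<close> is; hence they define a topology.\<close>

lemma openin_realization:
  "openin (realization X) U \<longleftrightarrow> U \<subseteq> realization_pre X // realization_rel X \<and>
      (\<forall>n. \<forall>x\<in>simplices X n.
        openin (subtopology (powertop_real UNIV) (standard_simplex n))
          {t \<in> standard_simplex n. realization_rel X `` {(n, x, t)} \<in> U})"
proof -
  let ?P = "\<lambda>U. \<forall>n. \<forall>x\<in>simplices X n.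
        openin (subtopology (powertop_real UNIV) (standard_simplex n))
          {t \<in> standard_simplex n. realization_rel X `` {(n, x, t)} \<in> U}"
  have "istopology (\<lambda>U. U \<subseteq> realization_pre X // realization_rel X \<and> ?P U)"
    unfolding istopology_def
  proof (rule conjI; intro allI impI)
    fix U V assume "U \<subseteq> realization_pre X // realization_rel X \<and> ?P U"
      and "V \<subseteq> realization_pre X // realization_rel X \<and> ?P V"
    then have U: "U \<subseteq> realization_pre X // realization_rel X" "?P U" and V: "?P V" by auto
    show "U \<inter> V \<subseteq> realization_pre X // realization_rel X \<and> ?P (U \<inter> V)"
    proof (intro conjI allI ballI)
      show "U \<inter> V \<subseteq> realization_pre X // realization_rel X" using U by auto
      fix n x assume x: "x \<in> simplices X n"
      have "{t \<in> standard_simplex n. realization_rel X `` {(n, x, t)} \<in> U \<inter> V} =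
        {t \<in> standard_simplex n. realization_rel X `` {(n, x, t)} \<in> U} \<inter>
        {t \<in> standard_simplex n. realization_rel X `` {(n, x, t)} \<in> V}" by auto
      then show "openin (subtopology (powertop_real UNIV) (standard_simplex n))
          {t \<in> standard_simplex n. realization_rel X `` {(n, x, t)} \<in> U \<inter> V}"
        using U(2) V x by (simp add: openin_Int)
    qed
  next
    fix K assume K: "\<forall>U\<in>K. U \<subseteq> realization_pre X // realization_rel X \<and> ?P U"
    show "\<Union>K \<subseteq> realization_pre X // realization_rel X \<and> ?P (\<Union>K)"
    proof (intro conjI allI ballI)
      show "\<Union>K \<subseteq> realization_pre X // realization_rel X" using K by blast
      fix n x assume x: "x \<in> simplices X n"
      have "{t \<in> standard_simplex n. realization_rel X `` {(n, x, t)} \<in> \<Union>K} =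
        (\<Union>U\<in>K. {t \<in> standard_simplex n. realization_rel X `` {(n, x, t)} \<in> U})" by auto
      then show "openin (subtopology (powertop_real UNIV) (standard_simplex n))
          {t \<in> standard_simplex n. realization_rel X `` {(n, x, t)} \<in> \<Union>K}"
        using K x by (auto intro!: openin_Union)
    qed
  qed
  then show ?thesis unfolding realization_def by (simp add: topology_inverse')
qed

lemma realization_class_in_quotient:
  "x \<in> simplices X n \<Longrightarrow> t \<in> standard_simplex n \<Longrightarrow>
    realization_rel X `` {(n, x, t)} \<in> realization_pre X // realization_rel X"
  by (rule quotientI) (simp add: realization_pre_def)

lemma topspace_realization: "topspace (realization X) = realization_pre X // realization_rel X"
proof
  show "topspace (realization X) \<subseteq> realization_pre X // realization_rel X"
    using openin_topspace openin_realization by blast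
  have "{t \<in> standard_simplex n. realization_rel X `` {(n, x, t)} \<in> realization_pre X // realization_rel X}
    = standard_simplex n" if "x \<in> simplices X n" for n x
    using realization_class_in_quotient[OF that] by auto
  then have "openin (realization X) (realization_pre X // realization_rel X)"
    unfolding openin_realization
    using openin_topspace[of "subtopology (powertop_real UNIV) (standard_simplex n)" for n] by simp
  then show "realization_pre X // realization_rel X \<subseteq> topspace (realization X)"
    by (rule openin_subset)
qed

lemma realization_class_cases:
  assumes "c \<in> topspace (realization X)"
  obtains n x t where "(n, x, t) \<in> c" "x \<in> simplices X n" "t \<in> standard_simplex n"
proof -
  obtain z where z: "z \<in> realization_pre X" "c = realization_rel X `` {z}"
    using assms unfolding topspace_realization by (rule quotientE)
  then have "z \<in> c" by (simp add: realization_rel_def)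
  then show ?thesis using z(1) that by (cases z) (auto simp: realization_pre_def)
qed

lemma realization_class_subset:
  assumes "c \<in> topspace (realization X)"
  shows "c \<subseteq> realization_pre X"
  using assms unfolding topspace_realization by (auto elim!: quotientE simp: realization_rel_def)

text \<open>The canonical map from the realization of a simplicial subset of the standard simplex to the
  topological simplex: the point \<open>t\<close> of the simplex \<open>x\<close> goes to its image under the affine extension
  of \<open>x\<close>, regarded as a map of vertices.\<close>

definition coords :: "nat \<times> (nat \<Rightarrow> nat) \<times> (nat \<Rightarrow> real) \<Rightarrow> nat \<Rightarrow> real" where
  "coords = (\<lambda>(n, x, t). simplex_push n x t)"

definition class_coords :: "(nat \<times> (nat \<Rightarrow> nat) \<times> (nat \<Rightarrow> real)) set \<Rightarrow> nat \<Rightarrow> real" where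
  "class_coords c = coords (SOME z. z \<in> c)"

context
  fixes n p :: nat and Y :: "(nat \<Rightarrow> nat) sset"
  defines "Y \<equiv> skeleton n (std_simplex p)"
begin

lemma coords_rel:
  assumes "(z, z') \<in> realization_rel Y"
  shows "coords z = coords z'"
proof -
  have gen: "coords a = coords b" if "(a, b) \<in> realization_gen Y" for a b
    using that by (auto simp: realization_gen_def coords_def Y_def skeleton_def simplex_push_compose)
  have "(z, z') \<in> (realization_gen Y \<union> (realization_gen Y)\<inverse>)\<^sup>*"
    using assms by (simp add: realization_rel_def)
  then show ?thesis
    by (induction rule: rtrancl_induct) (auto dest: gen)
qed

lemma class_coords_eq:
  assumes c: "c \<in> topspace (realization Y)" and z: "z \<in> c"
  shows "class_coords c = coords z"
proof -
  obtain z0 where "c = realization_rel Y `` {z0}"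
    using c unfolding topspace_realization by (rule quotientE)
  then have "coords z = coords z0" if "z \<in> c" for z using that coords_rel by auto
  moreover have "(SOME z. z \<in> c) \<in> c" using z by (rule someI)
  ultimately show ?thesis using z unfolding class_coords_def by metis
qed

lemma class_coords_of_simplex:
  assumes "x \<in> simplices Y m" "t \<in> standard_simplex m"
  shows "class_coords (realization_rel Y `` {(m, x, t)}) = simplex_push m x t"
proof -
  have "(m, x, t) \<in> realization_rel Y `` {(m, x, t)}"
    using assms by (simp add: realization_rel_def realization_pre_def)
  moreover have "realization_rel Y `` {(m, x, t)} \<in> topspace (realization Y)"
    unfolding topspace_realization by (rule realization_class_in_quotient) (use assms in auto)
  ultimately show ?thesis by (simp add: class_coords_eq coords_def)
qed

lemma skeleton_simplexE:
  assumes "x \<in> simplices Y m"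
  shows "x \<in> Delta_hom m p" "card (x ` {..m}) \<le> n + 1"
proof -
  obtain j \<theta> y where j: "j \<le> n" "\<theta> \<in> Delta_hom m j" "y \<in> Delta_hom j p" "x = compose {..m} y \<theta>"
    using assms by (auto simp: Y_def skeleton_def)
  show "x \<in> Delta_hom m p" unfolding j(4) by (rule Delta_hom_compose) (use j in auto)
  have "x ` {..m} \<subseteq> y ` {..j}"
    using Delta_hom_le[OF j(2)] by (auto simp: j(4) compose_eq)
  then have "card (x ` {..m}) \<le> card (y ` {..j})" by (intro card_mono) auto
  also have "\<dots> \<le> n + 1" using card_image_le[of "{..j}" y] j(1) by simp
  finally show "card (x ` {..m}) \<le> n + 1" .
qed

lemma continuous_map_class_coords:
  "continuous_map (realization Y) (powertop_real UNIV) class_coords"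
  unfolding continuous_map_def
proof (intro conjI allI impI)
  fix U :: "(nat \<Rightarrow> real) set" assume U: "openin (powertop_real UNIV) U"
  let ?V = "{c \<in> topspace (realization Y). class_coords c \<in> U}"
  show "openin (realization Y) ?V"
    unfolding openin_realization
  proof (intro conjI allI ballI)
    show "?V \<subseteq> realization_pre Y // realization_rel Y" by (auto simp: topspace_realization)
    fix m x assume x: "x \<in> simplices Y m"
    have "{t \<in> standard_simplex m. realization_rel Y `` {(m, x, t)} \<in> ?V} =
       {t \<in> topspace (subtopology (powertop_real UNIV) (standard_simplex m)). simplex_push m x t \<in> U}"
      using x by (auto simp: class_coords_of_simplex topspace_realization realization_class_in_quotient)
    moreover have "openin (subtopology (powertop_real UNIV) (standard_simplex m)) \<dots>"
      by (rule openin_continuous_map_preimage[OF continuous_map_simplex_push U])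
    ultimately show "openin (subtopology (powertop_real UNIV) (standard_simplex m))
      {t \<in> standard_simplex m. realization_rel Y `` {(m, x, t)} \<in> ?V}" by simp
  qed
qed auto

end

text \<open>A simplex of the \<open>n\<close>-skeleton has at most \<open>n + 1\<close> distinct vertices, so it misses one of the
  \<open>n + 2\<close> vertices of the standard simplex of dimension \<open>n + 1\<close>.\<close>

lemma class_coords_in_boundary:
  assumes "c \<in> topspace (realization (skeleton n (std_simplex (Suc n))))"
  shows "class_coords c \<in> {x \<in> standard_simplex (Suc n). \<exists>i\<le>Suc n. x i = 0}"
proof -
  obtain m x t where c: "(m, x, t) \<in> c" and x: "x \<in> simplices (skeleton n (std_simplex (Suc n))) m"
    and t: "t \<in> standard_simplex m"
    using assms by (rule realization_class_cases)
  have eq: "class_coords c = simplex_push m x t"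
    using class_coords_eq[OF assms c] by (simp add: coords_def)
  have "simplex_push m x t \<in> standard_simplex (Suc n)"
    using t Delta_hom_le[OF skeleton_simplexE(1)[OF x]] by (rule simplex_push_in_standard_simplex)
  moreover have "\<not> {..Suc n} \<subseteq> x ` {..m}"
  proof
    assume "{..Suc n} \<subseteq> x ` {..m}"
    then have "card {..Suc n} \<le> card (x ` {..m})" by (intro card_mono) auto
    then show False using skeleton_simplexE(2)[OF x] by simp
  qed
  then obtain i where "i \<le> Suc n" "i \<notin> x ` {..m}" by auto
  then have "simplex_push m x t i = 0" by (intro simplex_push_outside) auto
  ultimately show ?thesis using \<open>i \<le> Suc n\<close> eq by auto
qed

text \<open>A point in the image of a simplicial map whose simplices have all their vertices in \<open>S\<close> lies in
  the face spanned by \<open>S\<close>.  With naturality of a simplex of the homotopy limit, this puts the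
  singular simplex of a flag into the face spanned by the last set of the flag.\<close>

lemma class_coords_realization_map:
  assumes c: "c \<in> topspace (realization X)"
    and fc: "realization_map (skeleton n (std_simplex p)) f c \<in> topspace (realization (skeleton n (std_simplex p)))"
    and f: "\<And>m x j. x \<in> simplices X m \<Longrightarrow> j \<le> m \<Longrightarrow> f m x j \<in> S"
    and i: "i \<notin> S"
  shows "class_coords (realization_map (skeleton n (std_simplex p)) f c) i = 0"
proof -
  obtain z where z: "z \<in> realization_map (skeleton n (std_simplex p)) f c"
    using fc by (metis realization_class_cases)
  then obtain m x t where x: "(m, x, t) \<in> c"
    and rel: "((m, f m x, t), z) \<in> realization_rel (skeleton n (std_simplex p))"
    by (auto simp: realization_map_def)
  have "x \<in> simplices X m" using x realization_class_subset[OF c] by (auto simp: realization_pre_def)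
  then have "simplex_push m (f m x) t i = 0"
    using f i by (intro simplex_push_outside) metis
  then show ?thesis
    using class_coords_eq[OF fc z] coords_rel[OF rel] by (simp add: coords_def)
qed

section \<open>Flags as simplices of the nerve over an object\<close>

text \<open>The inclusion \<open>S \<subseteq> T\<close> as a map of the simplex category: both sets are identified with an
  initial segment of the natural numbers by enumerating them increasingly.\<close>

definition incl :: "nat set \<Rightarrow> nat set \<Rightarrow> nat \<Rightarrow> nat" where
  "incl S T = (\<lambda>i\<in>{..card S - 1}.
     inv_into {..<card T} (\<lambda>j. sorted_list_of_set T ! j) (sorted_list_of_set S ! i))"

lemma bij_betw_sorted_list_of_set:
  "finite T \<Longrightarrow> bij_betw (\<lambda>j. sorted_list_of_set T ! j) {..<card T} T"
  by (rule bij_betw_nth) auto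

lemma sorted_list_incl:
  assumes "finite T" "S \<subseteq> T" "i < card S"
  shows "incl S T i < card T" "sorted_list_of_set T ! (incl S T i) = sorted_list_of_set S ! i"
proof -
  have fS: "finite S" using assms finite_subset by blast
  have "sorted_list_of_set S ! i \<in> S"
    using bij_betw_sorted_list_of_set[OF fS] assms(3) by (auto simp: bij_betw_def)
  then have mem: "sorted_list_of_set S ! i \<in> (\<lambda>j. sorted_list_of_set T ! j) ` {..<card T}"
    using bij_betw_sorted_list_of_set[OF assms(1)] assms(2) by (auto simp: bij_betw_def)
  have i: "i \<le> card S - 1" using assms(3) by simp
  show "incl S T i < card T" using inv_into_into[OF mem] i by (simp add: incl_def)
  show "sorted_list_of_set T ! (incl S T i) = sorted_list_of_set S ! i"
    using f_inv_into_f[OF mem] i by (simp add: incl_def)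
qed

lemma incl_extensional: "incl S T \<in> extensional {..card S - 1}"
  by (simp add: incl_def)

lemma sorted_nth_le_iff:
  fixes T :: "nat set"
  assumes "finite T" "i < card T" "j < card T"
  shows "sorted_list_of_set T ! i \<le> sorted_list_of_set T ! j \<longleftrightarrow> i \<le> j"
proof
  show "i \<le> j \<Longrightarrow> sorted_list_of_set T ! i \<le> sorted_list_of_set T ! j"
    using assms by (intro sorted_nth_mono) auto
  assume le: "sorted_list_of_set T ! i \<le> sorted_list_of_set T ! j"
  show "i \<le> j"
  proof (rule ccontr)
    assume "\<not> i \<le> j"
    then have "sorted_list_of_set T ! j < sorted_list_of_set T ! i"
      using assms by (intro sorted_wrt_nth_less[where P = "(<)"]) (auto simp: strict_sorted_list_of_set)
    with le show False by simp
  qed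
qed

context
  fixes S T :: "nat set"
  assumes T: "finite T" and ST: "S \<subseteq> T" and S: "S \<noteq> {}"
begin

lemma nonempty_subset_card: "finite S" "0 < card S"
  using T ST S finite_subset card_gt_0_iff by blast+

lemma incl_Delta_hom: "incl S T \<in> Delta_hom (card S - 1) (card T - 1)"
proof (rule Delta_homI)
  fix i assume "i \<le> card S - 1"
  then have "i < card S" using nonempty_subset_card by linarith
  then show "incl S T i \<le> card T - 1" using sorted_list_incl(1)[OF T ST] by fastforce
next
  fix i j assume ij: "i \<le> j" "j \<le> card S - 1"
  then have "i < card S" "j < card S" using nonempty_subset_card by linarith+
  then show "incl S T i \<le> incl S T j"
    using ij(1) sorted_list_incl[OF T ST] sorted_nth_le_iff[OF T] sorted_nth_le_iff[OF nonempty_subset_card(1)]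
    by metis
qed (rule incl_extensional)

lemma incl_compose:
  assumes U: "finite U" and TU: "T \<subseteq> U"
  shows "compose {..card S - 1} (incl T U) (incl S T) = incl S U"
proof (rule extensionalityI[of _ "{..card S - 1}"])
  fix i assume "i \<in> {..card S - 1}"
  then have i: "i < card S" and i': "i \<in> {..card S - 1}" using nonempty_subset_card by auto
  have j: "incl S T i < card T" using i by (rule sorted_list_incl(1)[OF T ST])
  have SU: "S \<subseteq> U" using ST TU by blast
  have "sorted_list_of_set U ! (incl T U (incl S T i)) = sorted_list_of_set U ! (incl S U i)"
    using sorted_list_incl(2)[OF U TU j] sorted_list_incl(2)[OF T ST i] sorted_list_incl(2)[OF U SU i] by simp
  moreover have "incl T U (incl S T i) < card U" "incl S U i < card U"
    using sorted_list_incl(1)[OF U TU j] sorted_list_incl(1)[OF U SU i] by auto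
  ultimately have "incl T U (incl S T i) = incl S U i"
    using bij_betw_sorted_list_of_set[OF U] by (auto simp: bij_betw_def inj_on_def)
  then show "compose {..card S - 1} (incl T U) (incl S T) i = incl S U i"
    using i' by (simp add: compose_eq)
qed (use incl_extensional[of S U] in \<open>auto simp: compose_extensional\<close>)

end

lemma incl_refl:
  assumes "finite S" "S \<noteq> {}"
  shows "incl S S = (\<lambda>i\<in>{..card S - 1}. i)"
proof (rule extensionalityI[of _ "{..card S - 1}"])
  fix i assume "i \<in> {..card S - 1}"
  moreover have "0 < card S" using assms card_gt_0_iff by blast
  ultimately have i: "i < card S" "i \<in> {..card S - 1}" by auto
  then show "incl S S i = (\<lambda>i\<in>{..card S - 1}. i) i"
    using bij_betw_sorted_list_of_set[OF assms(1)] by (simp add: incl_def bij_betw_def inv_into_f_f)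
qed (use incl_extensional[of S S] in auto)

lemma incl_atMost:
  assumes "S \<subseteq> {..N}" "i < card S"
  shows "incl S {..N} i \<in> S"
proof -
  have fS: "finite S" using assms finite_subset by blast
  have eq: "sorted_list_of_set {..N} = [0..<Suc N]"
    using sorted_list_of_set_range[of 0 "Suc N"] by (simp only: atLeast0LessThan lessThan_Suc_atMost)
  have "incl S {..N} i < Suc N" using sorted_list_incl(1)[of "{..N}"] assms by simp
  then have "incl S {..N} i = sorted_list_of_set S ! i"
    using sorted_list_incl(2)[of "{..N}" S i] assms by (simp add: eq del: upt_Suc)
  then show ?thesis
    using bij_betw_sorted_list_of_set[OF fS] assms(2) by (auto simp: bij_betw_def)
qed

text \<open>A flag of nonempty subsets of \<open>S\<close> is a chain of inclusions over \<open>S\<close>.  This embeds the barycentric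
  subdivision of the simplex spanned by \<open>S\<close> into the nerve of the category over it.\<close>

definition flag_simplex :: "nat set \<Rightarrow> nat \<Rightarrow> (nat \<Rightarrow> nat set) \<Rightarrow> (nat, nat \<Rightarrow> nat) over_simplex" where
  "flag_simplex S q B =
    (\<lambda>i\<in>{..q}. (card (B i) - 1, incl (B i) S),
     \<lambda>(i, j)\<in>{(i, j). i \<le> j \<and> j \<le> q}. incl (B i) (B j))"

lemma flagD:
  assumes "flag N q B"
  shows "i \<le> q \<Longrightarrow> B i \<noteq> {}" "i \<le> q \<Longrightarrow> B i \<subseteq> {..N}" "i \<le> q \<Longrightarrow> finite (B i)"
    "i \<le> j \<Longrightarrow> j \<le> q \<Longrightarrow> B i \<subseteq> B j"
  using assms by (auto simp: flag_def intro: finite_subset[of _ "{..N}"])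

lemma flag_simplex_in_over_nerve:
  assumes B: "flag N q B" and S: "finite S" "B q \<subseteq> S" and r: "card S - 1 \<le> r"
  shows "flag_simplex S q B \<in> simplices (over_nerve r (card S - 1)) q"
proof -
  have sub: "B i \<subseteq> S" if "i \<le> q" for i using that S(2) flagD(4)[OF B that order_refl] by blast
  have card: "card (B i) - 1 \<le> r" if "i \<le> q" for i
    using card_mono[OF S(1) sub[OF that]] r by linarith
  show ?thesis
    unfolding flag_simplex_def over_nerve_iff
    using flagD[OF B] sub card S(1)
    by (auto simp: incl_Delta_hom incl_compose incl_refl simp del: One_nat_def)
qed

lemma flag_simplex_cong: "(\<And>i. i \<le> q \<Longrightarrow> B i = B' i) \<Longrightarrow> flag_simplex S q B = flag_simplex S q B'"
  by (auto simp: flag_simplex_def intro!: restrict_ext)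

lemma act_flag_simplex:
  "act (over_nerve r c) q (Suc q) (coface q k) (flag_simplex S (Suc q) B) = flag_simplex S q (B \<circ> skip k)"
  by (auto simp: nerve_def flag_simplex_def coface_def skip_def intro!: restrict_ext)

lemma over_nerve_map_flag_simplex:
  assumes B: "flag N q B" and S: "finite T" "B q \<subseteq> S" "S \<subseteq> T"
  shows "over_nerve_map (Delta_trunc r) (card S - 1) (card T - 1) (incl S T) q (flag_simplex S q B) =
    flag_simplex T q B"
proof -
  have sub: "B i \<subseteq> S" if "i \<le> q" for i using that S(2) flagD(4)[OF B that order_refl] by blast
  have "finite S" using S finite_subset by blast
  then show ?thesis
    using sub flagD(1)[OF B] S
    by (auto simp: over_nerve_map_def flag_simplex_def Delta_trunc_def incl_compose
        simp del: One_nat_def intro!: restrict_ext)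
qed

section \<open>Emptiness of Tot and pro-equivalence\<close>

lemma fib_simplices: "simplices (fib X) q = {\<sigma>. singular_simplex q (realization X) \<sigma>}"
  by (simp add: fib_def sing_def)

text \<open>Evaluating a simplex of the homotopy limit on the flags of subsets of \<open>{..Suc n}\<close>, and passing to
  barycentric coordinates, produces precisely a system of singular simplices as excluded above.  The
  hypothesis \<open>n + 1 \<le> k\<close> makes \<open>[n + 1]\<close> an object of the truncated simplex category.\<close>

lemma Tot_skeleton_empty:
  assumes k: "n + 1 \<le> k"
  shows "simplices (Tot k (sk n std_cosimplicial)) j = {}"
proof (rule ccontr)
  let ?N = "Suc n"
  let ?X = "sk n std_cosimplicial"
  let ?Y = "\<lambda>p. skeleton n (std_simplex p)"
  assume "simplices (Tot k ?X) j \<noteq> {}"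
  then obtain F where F: "natural_family k (fib_diagram ?X) j F"
    by (auto simp: Tot_iff)
  have ob: "ob (fib_diagram ?X) p = fib (?Y p)" for p
    by (simp add: fib_diagram_def sk_def std_cosimplicial_def)
  \<comment> \<open>The degenerate simplices at the vertex \<open>0\<close> of the standard \<open>j\<close>-simplex: restricting \<open>F\<close> to them
    gives a vertex of the homotopy limit.\<close>
  define z where "z q = (\<lambda>i\<in>{..q}. 0 :: nat)" for q :: nat
  have z: "z q \<in> Delta_hom q j" for q by (rule Delta_homI) (auto simp: z_def)
  have zc: "compose {..q} (z (Suc q)) (coface q i) = z q" for q i
    by (auto simp: z_def compose_def coface_def intro!: restrict_ext)
  have nerve: "flag_simplex {..?N} q B \<in> simplices (over_nerve k ?N) q" if "flag ?N q B" for q B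
    using flag_simplex_in_over_nerve[OF that, of "{..?N}" k] flagD(2)[OF that] k by simp
  define G where "G q B = F ?N q (flag_simplex {..?N} q B, z q)" for q B
  have G: "singular_simplex q (realization (?Y ?N)) (G q B)" if "flag ?N q B" for q B
    using natural_familyD(1)[OF F _ nerve[OF that] z, of ] k by (simp add: G_def ob fib_simplices)
  have Gtop: "G q B x \<in> topspace (realization (?Y ?N))" if "flag ?N q B" "x \<in> standard_simplex q" for q B x
    using G[OF that(1)] that(2) continuous_map_image_subset_topspace
    by (fastforce simp: singular_simplex_def)
  define g where "g q B = restrict (class_coords \<circ> G q B) (standard_simplex q)" for q B
  show False
  proof (rule no_flag_system_in_simplex_boundary[of ?N g])
    show "singular_simplex q (simplex_boundary ?N) (g q B)" if B: "flag ?N q B" for q B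
    proof -
      have "continuous_map (subtopology (powertop_real UNIV) (standard_simplex q)) (powertop_real UNIV)
          (class_coords \<circ> G q B)"
        by (rule continuous_map_compose[OF _ continuous_map_class_coords[of n ?N]])
          (use G[OF B] in \<open>simp add: singular_simplex_def\<close>)
      then have "continuous_map (subtopology (powertop_real UNIV) (standard_simplex q)) (powertop_real UNIV) (g q B)"
        by (rule continuous_map_eq) (simp add: g_def)
      then have "singular_simplex q (powertop_real UNIV) (g q B)"
        by (simp add: singular_simplex_def g_def)
      moreover have "g q B ` standard_simplex q \<subseteq> {x \<in> standard_simplex ?N. \<exists>i\<le>?N. x i = 0}"
        using class_coords_in_boundary[OF Gtop[OF B]] by (auto simp: g_def)
      ultimately show ?thesis
        unfolding simplex_boundary_def singular_simplex_subtopology by blast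
    qed
    show "g q B x i = 0" if B: "flag ?N q B" and x: "x \<in> standard_simplex q" and i: "i \<notin> B q" for q B x i
    proof -
      \<comment> \<open>The flag comes from a flag over \<open>B q\<close>, so naturality for the inclusion of \<open>B q\<close> applies.\<close>
      let ?S = "B q" let ?m = "card (B q) - 1" let ?u = "incl (B q) {..?N}"
      have S: "finite ?S" "?S \<noteq> {}" "?S \<subseteq> {..?N}" using flagD[OF B] by auto
      have cS: "0 < card ?S" using S card_gt_0_iff by blast
      have "card ?S \<le> card {..?N}" using S(3) by (intro card_mono) auto
      then have mk: "?m \<le> k" using k by simp
      have u: "?u \<in> Delta_hom ?m ?N"
        using incl_Delta_hom[of "{..?N}" ?S] S by simp
      let ?\<sigma> = "flag_simplex ?S q B"
      have \<sigma>: "?\<sigma> \<in> simplices (over_nerve k ?m) q"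
        by (rule flag_simplex_in_over_nerve[OF B S(1) order_refl mk])
      let ?H = "F ?m q (?\<sigma>, z q)"
      have H: "?H \<in> simplices (fib (?Y ?m)) q"
        using natural_familyD(1)[OF F mk \<sigma> z] by (simp add: ob)
      let ?f = "mor ?X ?m ?N ?u"
      have "over_nerve_map (Delta_trunc k) ?m ?N ?u q ?\<sigma> = flag_simplex {..?N} q B"
        using over_nerve_map_flag_simplex[OF B, of "{..?N}" ?S k] S by simp
      then have "G q B = mor (fib_diagram ?X) ?m ?N ?u q ?H"
        unfolding G_def using natural_familyD(3)[OF F mk \<sigma> z _ u] k by simp
      also have "\<dots> = fib_map (?Y ?m) (?Y ?N) ?f q ?H"
        by (simp add: fib_diagram_def sk_def std_cosimplicial_def)
      also have "\<dots> = restrict (realization_map (?Y ?N) ?f \<circ> ?H) (standard_simplex q)"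
        using H by (simp add: fib_map_def)
      finally have Gx: "G q B x = realization_map (?Y ?N) ?f (?H x)" using x by simp
      have Hx: "?H x \<in> topspace (realization (?Y ?m))"
        using H x continuous_map_image_subset_topspace
        by (fastforce simp: fib_simplices singular_simplex_def)
      have "class_coords (realization_map (?Y ?N) ?f (?H x)) i = 0"
      proof (rule class_coords_realization_map[OF Hx _ _ i])
        show "realization_map (?Y ?N) ?f (?H x) \<in> topspace (realization (?Y ?N))"
          using Gtop[OF B x] by (simp only: Gx)
        fix l y a assume y: "y \<in> simplices (?Y ?m) l" and a: "a \<le> l"
        have yD: "y \<in> Delta_hom l ?m" by (rule skeleton_simplexE(1)[OF y])
        have "?f l y = compose {..l} ?u y"
          using y yD by (simp add: sk_def std_cosimplicial_def)
        then have "?f l y a = ?u (y a)" using a by (simp add: compose_eq)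
        moreover have "y a < card ?S" using Delta_hom_le[OF yD a] cS by linarith
        ultimately show "?f l y a \<in> ?S" using incl_atMost[OF S(3)] by simp
      qed
      then show ?thesis using x by (simp add: g_def Gx)
    qed
    show "singular_face (Suc q) i (g (Suc q) B) = g q (B \<circ> skip i)" if B: "flag ?N (Suc q) B" and i: "i \<le> Suc q" for q B i
    proof -
      have "G q (B \<circ> skip i) = act (fib (?Y ?N)) q (Suc q) (coface q i) (G (Suc q) B)"
        using natural_familyD(2)[OF F _ nerve[OF B] z[of "Suc q"] coface_Delta_hom[of q i]] k
        by (simp add: G_def act_flag_simplex zc ob)
      then have Gf: "G q (B \<circ> skip i) = restrict (G (Suc q) B \<circ> simplex_push q (coface q i)) (standard_simplex q)"
        by (simp add: fib_def sing_def)
      have "singular_face (Suc q) i (g (Suc q) B) x = g q (B \<circ> skip i) x" for x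
      proof (cases "x \<in> standard_simplex q")
        case True
        have "simplical_face i x \<in> standard_simplex (Suc q)"
          by (rule simplical_face_in_standard_simplex) (use True i in auto)
        then show ?thesis using True simplex_push_coface[OF True i]
          by (simp add: singular_face_def g_def Gf)
      qed (simp add: singular_face_def g_def)
      then show ?thesis by blast
    qed
    show "g q B = g q B'" if "\<And>i. i \<le> q \<Longrightarrow> B i = B' i" for q B B'
      using flag_simplex_cong[of q B B'] that by (simp add: g_def G_def)
  qed
qed

lemma fib_simplices_empty:
  assumes "\<And>m. simplices X m = {}"
  shows "simplices (fib X) q = {}"
proof -
  have "topspace (realization X) = {}"
    by (simp add: topspace_realization realization_pre_def assms)
  then show ?thesis by (simp add: fib_simplices singular_simplex_empty)
qed

text \<open>The nerve over \<open>[0]\<close> has a simplex, which has nowhere to go.\<close>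

lemma Tot_const_empty:
  "simplices (Tot r (const_cosimplicial (empty_sset :: 'a sset))) j = {}"
proof (rule ccontr)
  let ?X = "const_cosimplicial (empty_sset :: 'a sset)"
  assume "simplices (Tot r ?X) j \<noteq> {}"
  then obtain F where F: "natural_family r (fib_diagram ?X) j F" by (auto simp: Tot_iff)
  have "flag 0 0 (\<lambda>_. {0})" by (simp add: flag_def)
  then have "flag_simplex {0} 0 (\<lambda>_. {0}) \<in> simplices (over_nerve r 0) 0"
    using flag_simplex_in_over_nerve[of 0 0 "\<lambda>_. {0}" "{0}" r] by simp
  moreover have "(\<lambda>i\<in>{..0}. 0) \<in> Delta_hom 0 j" by (rule Delta_homI) auto
  ultimately have "F 0 0 (flag_simplex {0} 0 (\<lambda>_. {0}), \<lambda>i\<in>{..0}. 0) \<in> simplices (ob (fib_diagram ?X) 0) 0"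
    by (intro natural_familyD(1)[OF F]) simp_all
  moreover have "simplices (fib (empty_sset :: 'a sset)) 0 = {}"
    by (rule fib_simplices_empty) (simp add: empty_sset_def)
  ultimately show False by (simp add: fib_diagram_def const_cosimplicial_def)
qed

text \<open>On components, the condition at stage \<open>s\<close> asks for a map out of the components of
  \<open>stage B (s + m)\<close>, which is empty; the conditions on homotopy groups range over basepoints in the
  stages of \<open>A\<close>, of which there are none.  Pro-equivalence needs a map out of the empty tower because
  the early stages of \<open>B\<close> may be nonempty and then admit no map to it.\<close>

lemma weak_pro_equivalence_from_empty:
  assumes A: "is_tower A" and A_empty: "\<And>s j. simplices (stage A s) j = {}"
    and B: "is_tower B" and B_empty: "\<And>s j. m \<le> s \<Longrightarrow> simplices (stage B s) j = {}"
  shows "weak_pro_equivalence A B (\<lambda>_ _ _. undefined)"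
proof -
  have fibA: "simplices (fib (stage A s)) q = {}" for s q
    by (rule fib_simplices_empty) (rule A_empty)
  have pi0A: "pi0 (stage A s) = {}" for s by (simp add: pi0_def fibA)
  have pi0B: "pi0 (stage B (s + m)) = {}" for s
    by (simp add: pi0_def fib_simplices_empty B_empty)
  have "tower_map A B (\<lambda>_ _ _. undefined)"
    by (simp add: tower_map_def sset_hom_def A_empty)
  moreover have "pi0_pro_iso A B (\<lambda>_ _ _. undefined)"
    unfolding pi0_pro_iso_def square_diagonal_def
  proof
    fix s
    show "\<exists>t. \<exists>h\<in>pi0 (stage B (s + t)) \<rightarrow> pi0 (stage A s).
       (\<forall>x\<in>pi0 (stage A (s + t)). h (pi0_map (stage A (s + t)) (stage B (s + t)) (\<lambda>_ _. undefined) x) =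
          pi0_map (stage A (s + t)) (stage A s) (bond A s (s + t)) x) \<and>
       (\<forall>y\<in>pi0 (stage B (s + t)). pi0_map (stage A s) (stage B s) (\<lambda>_ _. undefined) (h y) =
          pi0_map (stage B (s + t)) (stage B s) (bond B s (s + t)) y)"
      by (rule exI[of _ m]) (simp add: pi0A pi0B)
  qed
  moreover have "pi_pro_iso q A B (\<lambda>_ _ _. undefined)" for q
    by (simp add: pi_pro_iso_def fibA)
  ultimately show ?thesis using A B by (simp add: weak_pro_equivalence_def)
qed

theorem proposition2p5:
  fixes n :: nat
  shows "pro_equivalent (sk n std_cosimplicial) (const_cosimplicial empty_sset) \<and>
    (\<forall>k\<ge>n + 1. \<forall>j. simplices (Tot k (sk n std_cosimplicial)) j = {})"
proof
  let ?A = "Tot_tower (const_cosimplicial empty_sset) :: (nat, nat \<Rightarrow> nat, (nat \<Rightarrow> nat) fib) nat_family tower"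
  let ?B = "Tot_tower (sk n std_cosimplicial)"
  have "weak_pro_equivalence ?A ?B (\<lambda>_ _ _. undefined)"
    by (rule weak_pro_equivalence_from_empty[where m = "n + 1"])
      (simp_all add: is_tower_Tot_tower, simp_all add: Tot_tower_def Tot_const_empty Tot_skeleton_empty)
  then have "equivclp (\<lambda>A B. \<exists>f. weak_pro_equivalence A B f) ?A ?B"
    by (intro r_into_equivclp) blast
  then show "pro_equivalent (sk n std_cosimplicial) (const_cosimplicial empty_sset)"
    unfolding pro_equivalent_def pro_equivalent_towers_def by (rule equivclp_sym)
  show "\<forall>k\<ge>n + 1. \<forall>j. simplices (Tot k (sk n std_cosimplicial)) j = {}"
    using Tot_skeleton_empty by blast
qed

end
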